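(* Let $n\ge 7$ be an integer. Among all trees $T$ on $n$ vertices: (1) The path $P_n$ is the unique tree (up to isomorphism) maximizing $\operatorname{diam}(\mathcal{C}_3(T))$, and the maximum value is $\binom{\lceil n/2\rceil-1}{2}+\binom{\lfloor n/2\rfloor+2}{2}$. Equivalently: for every tree $T$ on $n\ge 7$ vertices, $\operatorname{diam}(\mathcal{C}_3(T))\le \binom{\lceil n/2\rceil-1}{2}+\binom{\lfloor n/2\rfloor+2}{2}$, with equality if and only if $T\cong P_n$. (2) The minimum value of $\operatorname{diam}(\mathcal{C}_3(T))$ is $\lfloor 3n/2\rfloor$, and the trees attaining it are exactly the star $K_{1,n-1}$ and the double stars $S(a,b)$ (with $a,b\ge 1$, $a+b+2=n$) satisfying $|a-b|\le 4$.
   Context: All trees are finite. A proper 3-coloring of a tree $T=(V,E)$ is a map $f\colon V\to\mathbb{Z}/3\mathbb{Z}$ with $f(u)\ne f(v)$ for every edge $uv\in E$. The 3-coloring graph $\mathcal{C}_3(T)$ is the graph whose vertices are the proper 3-colorings of $T$, two colorings being adjacent iff they differ at exactly one vertex; $\operatorname{diam}(\mathcal{C}_3(T))$ is its graph diameter. The double star $S(a,b)$ is the tree obtained by joining the centers of the stars $K_{1,a}$ and $K_{1,b}$ by an edge; it has $a+b+2$ vertices. *)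

theory Defs
  imports Main "HOL-Library.FuncSet"
begin

text \<open>Finite simple graphs given by a vertex set V and a set E of 2-element vertex sets.\<close>

definition simple_graph :: "'a set \<Rightarrow> 'a set set \<Rightarrow> bool" where
  "simple_graph V E \<longleftrightarrow> finite V \<and>
     (\<forall>e\<in>E. \<exists>u v. e = {u, v} \<and> u \<in> V \<and> v \<in> V \<and> u \<noteq> v)"

definition adj_rel :: "'a set set \<Rightarrow> ('a \<times> 'a) set" where
  "adj_rel E = {(u, v). {u, v} \<in> E}"

definition connected_graph :: "'a set \<Rightarrow> 'a set set \<Rightarrow> bool" where
  "connected_graph V E \<longleftrightarrow> V \<noteq> {} \<and> (\<forall>u\<in>V. \<forall>v\<in>V. (u, v) \<in> (adj_rel E)\<^sup>*)"

text \<open>A cycle: at least 3 distinct vertices, consecutive ones adjacent, last adjacent to first.\<close>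
definition is_cycle :: "'a set set \<Rightarrow> 'a list \<Rightarrow> bool" where
  "is_cycle E xs \<longleftrightarrow> length xs \<ge> 3 \<and> distinct xs \<and>
     (\<forall>i. Suc i < length xs \<longrightarrow> {xs ! i, xs ! Suc i} \<in> E) \<and>
     {last xs, hd xs} \<in> E"

definition is_tree :: "'a set \<Rightarrow> 'a set set \<Rightarrow> bool" where
  "is_tree V E \<longleftrightarrow> simple_graph V E \<and> connected_graph V E \<and> (\<nexists>xs. is_cycle E xs)"

definition graph_iso :: "'a set \<Rightarrow> 'a set set \<Rightarrow> 'b set \<Rightarrow> 'b set set \<Rightarrow> bool" where
  "graph_iso V E V' E' \<longleftrightarrow> (\<exists>f. bij_betw f V V' \<and>
     (\<forall>u\<in>V. \<forall>v\<in>V. {u, v} \<in> E \<longleftrightarrow> {f u, f v} \<in> E'))"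

text \<open>Proper 3-colourings (colours 0,1,2 standing for Z/3Z), as extensional functions on V.\<close>
definition colorings3 :: "'a set \<Rightarrow> 'a set set \<Rightarrow> ('a \<Rightarrow> nat) set" where
  "colorings3 V E = {f. f \<in> V \<rightarrow>\<^sub>E {0, 1, 2} \<and> (\<forall>u v. {u, v} \<in> E \<longrightarrow> f u \<noteq> f v)}"

text \<open>Edges of the 3-colouring graph: colourings differing at exactly one vertex.\<close>
definition col_adj :: "'a set \<Rightarrow> 'a set set \<Rightarrow> (('a \<Rightarrow> nat) \<times> ('a \<Rightarrow> nat)) set" where
  "col_adj V E = {(f, g). f \<in> colorings3 V E \<and> g \<in> colorings3 V E \<and>
                          card {v\<in>V. f v \<noteq> g v} = 1}"

text \<open>Graph distance in the colouring graph (length of a shortest walk).\<close>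
definition col_dist :: "'a set \<Rightarrow> 'a set set \<Rightarrow> ('a \<Rightarrow> nat) \<Rightarrow> ('a \<Rightarrow> nat) \<Rightarrow> nat" where
  "col_dist V E f g = (LEAST k. (f, g) \<in> (col_adj V E) ^^ k)"

definition diam_C3 :: "'a set \<Rightarrow> 'a set set \<Rightarrow> nat" where
  "diam_C3 V E = Max {col_dist V E f g | f g. f \<in> colorings3 V E \<and> g \<in> colorings3 V E}"

text \<open>Concrete trees on vertex set {0..<n}.\<close>
definition path_V :: "nat \<Rightarrow> nat set" where "path_V n = {0..<n}"
definition path_E :: "nat \<Rightarrow> nat set set" where
  "path_E n = {{i, Suc i} | i. Suc i < n}"

definition star_E :: "nat \<Rightarrow> nat set set" where
  "star_E n = {{0, i} | i. 1 \<le> i \<and> i < n}"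

text \<open>Double star S(a,b): centres 0 and 1, leaves 2..a+1 on 0 and a+2..a+b+1 on 1.\<close>
definition dstar_E :: "nat \<Rightarrow> nat \<Rightarrow> nat set set" where
  "dstar_E a b = {{0, 1}} \<union> {{0, i} | i. 2 \<le> i \<and> i < a + 2}
                           \<union> {{1, i} | i. a + 2 \<le> i \<and> i < a + b + 2}"

end

theory Submission
  imports Defs
begin

text \<open>
  On a tree the pointwise difference modulo 3 of two colourings lifts to a map \<open>d\<close> into the integers
  that changes by at most 1 along edges; the lift is unique up to adding multiples of 3. Recolouring
  one vertex changes \<open>d\<close> by 1 there, and conversely some vertex can always be recoloured so as to
  decrease the sum of \<open>\<bar>d v\<bar>\<close>. So the distance of the two colourings is the minimum over \<open>k\<close> of
  the sum of \<open>\<bar>d v - 3 * k\<bar>\<close>, and the diameter is the maximum of this minimum over all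
  1-Lipschitz \<open>d\<close>.

  For the upper bound, the values of \<open>d\<close> form an interval, so the deviations on each side of \<open>3 * k\<close>
  sum to at most a triangular number; a suitable multiple of 3 near the median gives the bound, with
  equality only if \<open>d\<close> is injective, in which case the tree is a path. For the lower bound, take \<open>d\<close>
  with values 1 and 2, balanced. If \<open>d\<close> stays in a band from \<open>3 * k\<close> to \<open>3 * k + 3\<close>, nothing better
  than \<open>3 * n div 2\<close> is possible. One does better when truncated distances from some
  neighbour of a leaf have a sum exceeding \<open>3 * n div 2\<close>; two non-adjacent such neighbours always
  provide this, and trees without such a pair are stars and double stars.
\<close>

section \<open>Lifted differences of colourings\<close>

text \<open>Let \<open>p\<close> vertices have \<open>d v \<le> 3 * k\<close> and \<open>q\<close>
  vertices lie above. The triangular bounds give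
  \<open>2 * offset_cost V d k \<le> p * (p - 1) + q * (q + 1)\<close>, which is at most
  \<open>L * (L - 1) + U * (U - 1)\<close> as soon as \<open>L \<le> p \<le> U\<close> and
  \<open>L + U = n + 1\<close>. The obstacle is that cuts exist only at multiples of 3, so
  \<open>p\<close> may jump over the window from \<open>L\<close> to \<open>U\<close>. A wider
  window is easier to hit but gives a larger bound; \<open>U \<le> L + 3\<close> is the limit up to
  which a path with \<open>L - 1\<close> vertices below 0 does not become cheaper when the centre
  moves from 0 to 3. This makes \<open>L\<close> and \<open>U\<close> the upper entries of the two
  binomial coefficients. The 4 for double stars comes from comparing \<open>1 + a + 2 * b\<close>,
  the cost bound when the centre with \<open>a\<close> leaves sits at a multiple of 3, with
  \<open>3 * (a + b + 2) / 2\<close>: the former is larger exactly when \<open>b > a + 4\<close>.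
  The hypothesis \<open>n \<ge> 7\<close> gives \<open>L \<ge> 3\<close>, needed when the window is
  jumped over, and \<open>4 * n - 6 \<ge> 3 * n + 1\<close>, needed for two leaf neighbours at
  distance 2.\<close>

definition lipschitz1 :: "'a set set \<Rightarrow> ('a \<Rightarrow> int) \<Rightarrow> bool" where
  "lipschitz1 E d \<longleftrightarrow> (\<forall>u v. {u, v} \<in> E \<longrightarrow> \<bar>d u - d v\<bar> \<le> 1)"

definition lift3 :: "'a set \<Rightarrow> 'a set set \<Rightarrow> ('a \<Rightarrow> int) \<Rightarrow> ('a \<Rightarrow> int) \<Rightarrow> bool" where
  "lift3 V E \<phi> d \<longleftrightarrow> lipschitz1 E d \<and> (\<forall>v\<in>V. d v mod 3 = \<phi> v mod 3)"

definition offset_cost :: "'a set \<Rightarrow> ('a \<Rightarrow> int) \<Rightarrow> int \<Rightarrow> int" where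
  "offset_cost V d k = (\<Sum>v\<in>V. \<bar>d v - 3 * k\<bar>)"

text \<open>Lifts and bipartitions extend over a new leaf, so induction along this construction
  replaces arguments about the absence of cycles. \<open>tree_grown\<close> shows that every tree
  arises in this way.\<close>

inductive grown_tree :: "'a set \<Rightarrow> 'a set set \<Rightarrow> bool" where
  singleton: "grown_tree {r} {}"
| add_leaf: "grown_tree V E \<Longrightarrow> y \<in> V \<Longrightarrow> x \<notin> V \<Longrightarrow> grown_tree (insert x V) (insert {x, y} E)"

section \<open>Simple graphs and trees grown leaf by leaf\<close>

lemma lipschitz1D: "lipschitz1 E d \<Longrightarrow> {u, v} \<in> E \<Longrightarrow> \<bar>d u - d v\<bar> \<le> 1"
  by (auto simp: lipschitz1_def)

lemma simple_graph_edgeD: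
  assumes "simple_graph V E" "{u, v} \<in> E"
  shows "u \<in> V" "v \<in> V" "u \<noteq> v"
proof -
  obtain a b where ab: "{u, v} = {a, b}" "a \<in> V" "b \<in> V" "a \<noteq> b"
    using assms unfolding simple_graph_def by blast
  show "u \<in> V" "v \<in> V" "u \<noteq> v" using ab by (auto simp: doubleton_eq_iff)
qed

lemma simple_graph_finite: "simple_graph V E \<Longrightarrow> finite V"
  by (simp add: simple_graph_def)

lemma adj_rel_iff: "(u, v) \<in> adj_rel E \<longleftrightarrow> {u, v} \<in> E"
  by (simp add: adj_rel_def)

lemma sym_adj_rel: "sym (adj_rel E)"
  by (auto simp: sym_def adj_rel_def insert_commute)

lemma grown_tree_simple: "grown_tree V E \<Longrightarrow> simple_graph V E"
proof (induction rule: grown_tree.induct)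
  case (add_leaf V E y x)
  have "\<exists>u v. e = {u, v} \<and> u \<in> insert x V \<and> v \<in> insert x V \<and> u \<noteq> v"
    if "e \<in> insert {x, y} E" for e
  proof (cases "e = {x, y}")
    case True
    then show ?thesis using add_leaf by blast
  next
    case False
    then have "e \<in> E" using that by simp
    then show ?thesis using add_leaf.IH unfolding simple_graph_def by blast
  qed
  then show ?case using add_leaf.IH by (simp add: simple_graph_def)
qed (simp add: simple_graph_def)

lemma grown_tree_connected: "grown_tree V E \<Longrightarrow> connected_graph V E"
proof (induction rule: grown_tree.induct)
  case (add_leaf V E y x)
  let ?R = "adj_rel (insert {x, y} E)"
  have sub: "(adj_rel E)\<^sup>* \<subseteq> ?R\<^sup>*"
    by (rule rtrancl_mono) (auto simp: adj_rel_def)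
  have symR: "sym (?R\<^sup>*)" by (rule sym_rtrancl[OF sym_adj_rel])
  have xy: "(x, y) \<in> ?R\<^sup>*" by (auto simp: adj_rel_def)
  have toy: "(u, y) \<in> ?R\<^sup>*" if "u \<in> insert x V" for u
    using that xy sub add_leaf.IH add_leaf.hyps unfolding connected_graph_def by blast
  have "(u, v) \<in> ?R\<^sup>*" if "u \<in> insert x V" "v \<in> insert x V" for u v
    using toy[OF that(1)] symD[OF symR toy[OF that(2)]] by (rule rtrancl_trans)
  then show ?case by (auto simp: connected_graph_def)
qed (simp add: connected_graph_def)

text \<open>A new leaf is constrained by a single neighbour, and every residue has a representative
  within 1 of that neighbour's value.\<close>

lemma grown_tree_lift: "grown_tree V E \<Longrightarrow> \<exists>d. lift3 V E \<phi> d"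
proof (induction rule: grown_tree.induct)
  case (singleton r)
  show ?case by (rule exI[of _ \<phi>]) (simp add: lift3_def lipschitz1_def)
next
  case (add_leaf V E y x)
  then obtain d where d: "lift3 V E \<phi> d" by blast
  \<comment> \<open>The offset added to \<open>d y\<close> is the representative of
    \<open>\<phi> x - d y\<close> modulo 3 among -1, 0 and 1.\<close>
  define e where "e = d(x := d y + ((\<phi> x - d y + 1) mod 3 - 1))"
  have nx: "{u, v} \<in> E \<Longrightarrow> u \<noteq> x \<and> v \<noteq> x" for u v
    using simple_graph_edgeD[OF grown_tree_simple[OF add_leaf.hyps(1)]] add_leaf.hyps(3) by metis
  have yx: "y \<noteq> x" using add_leaf.hyps by auto
  have "0 \<le> (\<phi> x - d y + 1) mod 3" "(\<phi> x - d y + 1) mod 3 < 3" by simp_all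
  then have bnd: "\<bar>e x - e y\<bar> \<le> 1" using yx unfolding e_def by simp
  have "lipschitz1 (insert {x, y} E) e"
    unfolding lipschitz1_def
  proof (intro allI impI)
    fix u v assume "{u, v} \<in> insert {x, y} E"
    then consider "{u, v} = {x, y}" | "{u, v} \<in> E" by blast
    then show "\<bar>e u - e v\<bar> \<le> 1"
    proof cases
      case 1
      then show ?thesis using bnd by (auto simp: doubleton_eq_iff)
    next
      case 2
      then show ?thesis using nx[OF 2] lipschitz1D[of E d u v] d by (simp add: e_def lift3_def)
    qed
  qed
  moreover have "e x mod 3 = \<phi> x mod 3"
    unfolding e_def by simp presburger
  ultimately have "lift3 (insert x V) (insert {x, y} E) \<phi> e"
    using d by (auto simp: lift3_def e_def)
  then show ?case by blast
qed

lemma grown_tree_bipartite: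
  "grown_tree V E \<Longrightarrow> \<exists>b :: 'a \<Rightarrow> bool. \<forall>u v. {u, v} \<in> E \<longrightarrow> b u \<noteq> b v"
proof (induction rule: grown_tree.induct)
  case (add_leaf V E y x)
  then obtain b :: "'a \<Rightarrow> bool" where b: "\<forall>u v. {u, v} \<in> E \<longrightarrow> b u \<noteq> b v" by blast
  have nx: "{u, v} \<in> E \<Longrightarrow> u \<noteq> x \<and> v \<noteq> x" for u v
    using simple_graph_edgeD[OF grown_tree_simple[OF add_leaf.hyps(1)]] add_leaf.hyps(3) by metis
  show ?case
    by (rule exI[of _ "b(x := \<not> b y)"])
       (use b nx add_leaf.hyps in \<open>auto simp: doubleton_eq_iff\<close>)
qed simp

lemma rtrancl_crossing:
  assumes "(u, v) \<in> r\<^sup>*" "P u" "\<not> P v"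
  shows "\<exists>a b. (a, b) \<in> r \<and> P a \<and> \<not> P b"
  using assms by (induction rule: rtrancl_induct) blast+

lemma connected_crossing:
  assumes "simple_graph V E" "connected_graph V E" "u \<in> V" "v \<in> V" "P u" "\<not> P v"
  shows "\<exists>a\<in>V. \<exists>b\<in>V. {a, b} \<in> E \<and> P a \<and> \<not> P b"
proof -
  have "(u, v) \<in> (adj_rel E)\<^sup>*" using assms by (auto simp: connected_graph_def)
  from rtrancl_crossing[of _ _ _ P, OF this assms(5,6)] show ?thesis
    using simple_graph_edgeD[OF assms(1)] by (metis adj_rel_iff)
qed

section \<open>Walks of recolourings and lifts\<close>

lemma colorings3D:
  assumes "f \<in> colorings3 V E"
  shows "v \<in> V \<Longrightarrow> f v = 0 \<or> f v = 1 \<or> f v = 2" "{u, v} \<in> E \<Longrightarrow> f u \<noteq> f v"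
  using assms by (auto simp: colorings3_def PiE_def Pi_def)

lemma colorings3_eqI:
  assumes "f \<in> colorings3 V E" "g \<in> colorings3 V E" "\<And>v. v \<in> V \<Longrightarrow> f v = g v"
  shows "f = g"
  using assms unfolding colorings3_def by (auto intro: PiE_ext)

lemma finite_colorings3: "finite V \<Longrightarrow> finite (colorings3 V E)"
  by (rule finite_subset[of _ "V \<rightarrow>\<^sub>E {0, 1, 2}"]) (auto simp: colorings3_def intro: finite_PiE)

lemma mod3_neq_if_diff_1: "\<bar>x - y\<bar> = 1 \<Longrightarrow> x mod 3 \<noteq> y mod 3" for x y :: int
  by presburger

lemma colour_eqI:
  fixes a b :: nat
  assumes "a = 0 \<or> a = 1 \<or> a = 2" "b = 0 \<or> b = 1 \<or> b = 2" "int a mod 3 = int b mod 3"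
  shows "a = b"
  using assms by (elim disjE; simp)

text \<open>Vertex \<open>v\<close> is recoloured from \<open>gv\<close> to \<open>g'\<close> next
  to \<open>u\<close>. Since \<open>gu\<close> differs from both, it is the third colour,
  \<open>gv - s\<close> modulo 3. The only bad difference \<open>x - y = - s\<close> would then
  force the initial colours \<open>fu\<close> and \<open>fv\<close> to agree.\<close>

lemma recolour_keeps_lipschitz:
  fixes fu fv gu gv g' :: nat and x y s :: int
  assumes "fu = 0 \<or> fu = 1 \<or> fu = 2" "fv = 0 \<or> fv = 1 \<or> fv = 2"
    and "gu = 0 \<or> gu = 1 \<or> gu = 2" "gv = 0 \<or> gv = 1 \<or> gv = 2" "g' = 0 \<or> g' = 1 \<or> g' = 2"
    and "fu \<noteq> fv" "gu \<noteq> gv" "gu \<noteq> g'" "gv \<noteq> g'"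
    and "x mod 3 = (int gu - int fu) mod 3" "y mod 3 = (int gv - int fv) mod 3" "\<bar>x - y\<bar> \<le> 1"
    and "s = (if (int g' - int gv) mod 3 = 1 then 1 else - 1)"
  shows "\<bar>x - (y + s)\<bar> \<le> 1"
proof -
  have s: "s = 1 \<or> s = - 1" using assms(13) by auto
  have "int gu mod 3 = (int gv - s) mod 3"
    using assms(3-5,7-9) unfolding assms(13) by (elim disjE; simp)
  then have 1: "3 dvd (int gv - s) - int gu" by (metis mod_eq_dvd_iff)
  have 2: "3 dvd (x - y) - ((int gu - int fu) - (int gv - int fv))"
    using assms(10,11) by (metis mod_diff_cong mod_eq_dvd_iff)
  have "x - y \<noteq> - s"
  proof
    assume A: "x - y = - s"
    have "3 dvd (x - y + s) + (int fu - int fv)"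
      using dvd_diff[OF 2 1] by (simp add: algebra_simps)
    then have "3 dvd int fu - int fv" using A by simp
    then show False using colour_eqI[OF assms(1,2)] assms(6) by (simp add: mod_eq_dvd_iff)
  qed
  then show ?thesis using assms(12) s by auto
qed

text \<open>The lift is followed along the walk: each recolouring moves it at one vertex by 1 or -1,
  so the sum of absolute values grows by at most 1 per step.\<close>

lemma walk_gives_lift:
  assumes "simple_graph V E" "f \<in> colorings3 V E" "(f, g) \<in> col_adj V E ^^ k"
  shows "g \<in> colorings3 V E \<and>
    (\<exists>d. lift3 V E (\<lambda>v. int (g v) - int (f v)) d \<and> (\<Sum>v\<in>V. \<bar>d v\<bar>) \<le> int k)"
  using assms(3)
proof (induction k arbitrary: g)
  case 0
  have "lift3 V E (\<lambda>v. int (g v) - int (f v)) (\<lambda>_. 0)" using 0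
    by (auto simp: lift3_def lipschitz1_def)
  then show ?case using 0 assms(2) by (auto intro!: exI[of _ "\<lambda>_. 0"])
next
  case (Suc k)
  then obtain g0 where g0: "(f, g0) \<in> col_adj V E ^^ k" "(g0, g) \<in> col_adj V E" by auto
  obtain d where d: "lift3 V E (\<lambda>v. int (g0 v) - int (f v)) d" "(\<Sum>v\<in>V. \<bar>d v\<bar>) \<le> int k"
    using Suc.IH[OF g0(1)] by blast
  have col: "g0 \<in> colorings3 V E" "g \<in> colorings3 V E" "card {v\<in>V. g0 v \<noteq> g v} = 1"
    using g0(2) by (auto simp: col_adj_def)
  obtain w where "{v\<in>V. g0 v \<noteq> g v} = {w}" using col(3) card_1_singletonE by metis
  then have w: "w \<in> V" "g0 w \<noteq> g w" "\<And>v. v \<in> V \<Longrightarrow> v \<noteq> w \<Longrightarrow> g0 v = g v" by auto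
  define s :: int where "s = (if (int (g w) - int (g0 w)) mod 3 = 1 then 1 else - 1)"
  define e where "e = d(w := d w + s)"
  have dm: "d v mod 3 = (int (g0 v) - int (f v)) mod 3" if "v \<in> V" for v
    using d(1) that by (auto simp: lift3_def)
  have key: "\<bar>d u - (d w + s)\<bar> \<le> 1" if uw: "{u, w} \<in> E" for u
  proof -
    note se = simple_graph_edgeD[OF assms(1) uw]
    have "g0 u \<noteq> g w" using w(3)[OF se(1) se(3)] colorings3D(2)[OF col(2) uw] by simp
    moreover have "\<bar>d u - d w\<bar> \<le> 1" using d(1) uw by (auto simp: lift3_def lipschitz1_def)
    ultimately show ?thesis
      using recolour_keeps_lipschitz[OF colorings3D(1)[OF assms(2) se(1)]
          colorings3D(1)[OF assms(2) se(2)] colorings3D(1)[OF col(1) se(1)]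
          colorings3D(1)[OF col(1) se(2)] colorings3D(1)[OF col(2) se(2)]
          colorings3D(2)[OF assms(2) uw] colorings3D(2)[OF col(1) uw] _ w(2)
          dm[OF se(1)] dm[OF se(2)] _ s_def] by blast
  qed
  have "lipschitz1 E e"
    unfolding lipschitz1_def
  proof (intro allI impI)
    fix u v assume uv: "{u, v} \<in> E"
    note se = simple_graph_edgeD[OF assms(1) uv]
    have vu: "{v, u} \<in> E" using uv by (simp add: insert_commute)
    show "\<bar>e u - e v\<bar> \<le> 1"
      using key[of u] key[of v] uv vu se(3) lipschitz1D[of E d u v] d(1)
      by (auto simp: e_def lift3_def abs_minus_commute)
  qed
  moreover have "e v mod 3 = (int (g v) - int (f v)) mod 3" if "v \<in> V" for v
  proof (cases "v = w")
    case True
    have cs: "g0 w = 0 \<or> g0 w = 1 \<or> g0 w = 2" "g w = 0 \<or> g w = 1 \<or> g w = 2"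
      using colorings3D(1)[OF col(1) w(1)] colorings3D(1)[OF col(2) w(1)] .
    have "s mod 3 = (int (g w) - int (g0 w)) mod 3"
      using cs w(2) unfolding s_def by (elim disjE; simp)
    then have "(d w + s) mod 3 = ((int (g0 w) - int (f w)) + (int (g w) - int (g0 w))) mod 3"
      using dm[OF w(1)] by (metis mod_add_cong)
    then show ?thesis using True by (simp add: e_def)
  next
    case False
    then show ?thesis using dm[OF that] w(3)[OF that] by (simp add: e_def)
  qed
  ultimately have "lift3 V E (\<lambda>v. int (g v) - int (f v)) e" by (simp add: lift3_def)
  moreover have "(\<Sum>v\<in>V. \<bar>e v\<bar>) \<le> int (Suc k)"
  proof -
    have fin: "finite V" using assms(1) by (rule simple_graph_finite)
    have "(\<Sum>v\<in>V. \<bar>e v\<bar>) \<le> (\<Sum>v\<in>V. \<bar>d v\<bar> + (if v = w then 1 else 0))"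
      by (rule sum_mono) (auto simp: e_def s_def)
    also have "\<dots> = (\<Sum>v\<in>V. \<bar>d v\<bar>) + 1"
      using fin w(1) by (simp add: sum.distrib)
    finally show ?thesis using d(2) by simp
  qed
  ultimately show ?case using col(2) by blast
qed

lemma finite_ex_max:
  fixes h :: "'a \<Rightarrow> int"
  assumes "finite P" "P \<noteq> {}"
  shows "\<exists>v\<in>P. \<forall>u\<in>P. h u \<le> h v"
proof -
  have "Max (h ` P) \<in> h ` P" using assms by (intro Max_in) auto
  then obtain v where "v \<in> P" "h v = Max (h ` P)" by auto
  then show ?thesis using assms(1) by (metis Max_ge finite_imageI imageI)
qed

text \<open>Among the vertices that must move in a given direction, one of extremal height has all its
  neighbours on the same side, so it can be recoloured at once.\<close>

lemma lift_gives_walk: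
  assumes T: "grown_tree V E" and g: "g \<in> colorings3 V E"
  shows "f \<in> colorings3 V E \<Longrightarrow> lift3 V E (\<lambda>v. int (g v) - int (f v)) d \<Longrightarrow>
    (\<Sum>v\<in>V. \<bar>d v\<bar>) = int N \<Longrightarrow> (f, g) \<in> col_adj V E ^^ N"
proof (induction N arbitrary: f d)
  note sg = grown_tree_simple[OF T]
  note fin = simple_graph_finite[OF sg]
  case 0
  have "\<forall>v\<in>V. d v = 0" using 0(3) fin by (simp add: sum_nonneg_eq_0_iff)
  then have "\<forall>v\<in>V. (int (g v) - int (f v)) mod 3 = 0"
    using 0(2) by (auto simp: lift3_def)
  then have "f v = g v" if "v \<in> V" for v
    using colour_eqI[OF colorings3D(1)[OF g that] colorings3D(1)[OF 0(1) that]] that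
    by (simp add: mod_eq_dvd_iff mod_eq_0_iff_dvd)
  then have "f = g" using colorings3_eqI 0(1) g by blast
  then show ?case by simp
next
  note sg = grown_tree_simple[OF T]
  note fin = simple_graph_finite[OF sg]
  case (Suc N)
  have dm: "d v mod 3 = (int (g v) - int (f v)) mod 3" if "v \<in> V" for v
    using Suc.prems(2) that by (auto simp: lift3_def)
  \<comment> \<open>The height \<open>h\<close> lifts the colouring \<open>f\<close> itself; as
    \<open>f\<close> is proper, it changes by exactly 1 along every edge.\<close>
  obtain h where h: "lift3 V E (\<lambda>v. int (f v)) h" using grown_tree_lift[OF T] by blast
  have hm: "h v mod 3 = int (f v) mod 3" if "v \<in> V" for v
    using h that by (auto simp: lift3_def)
  have "\<exists>w\<in>V. d w \<noteq> 0" using Suc.prems(3) by (metis abs_0 of_nat_0 of_nat_eq_iff nat.distinct(1) sum.neutral)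
  then obtain w where w: "w \<in> V" "d w \<noteq> 0" by blast
  define s :: int where "s = sgn (d w)"
  have s: "s = 1 \<or> s = - 1" using w by (auto simp: s_def sgn_if)
  define P where "P = {v\<in>V. s * d v > 0}"
  have "w \<in> P" using w by (auto simp: P_def s_def sgn_if)
  then obtain v where v: "v \<in> P" "\<And>u. u \<in> P \<Longrightarrow> s * h u \<le> s * h v"
    using finite_ex_max[of P "\<lambda>u. s * h u"] fin by (auto simp: P_def)
  have vV: "v \<in> V" and dv: "s * d v > 0" using v by (auto simp: P_def)
  \<comment> \<open>A neighbour on the other side would exceed the extremal height, hence lie
    outside \<open>P\<close>. This forces \<open>d u = 0\<close> and \<open>d v = s\<close>, and
    then \<open>u\<close> and \<open>v\<close> would have the same target colour.\<close>
  have nb: "h u = h v - s" if uv: "{u, v} \<in> E" for u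
  proof (rule ccontr)
    assume ne: "h u \<noteq> h v - s"
    note se = simple_graph_edgeD[OF sg uv]
    have "\<bar>h u - h v\<bar> \<le> 1" using h uv by (auto simp: lift3_def lipschitz1_def)
    moreover have "h u \<noteq> h v"
      using hm[OF se(1)] hm[OF se(2)] colorings3D(2)[OF Suc.prems(1) uv]
        colour_eqI[OF colorings3D(1)[OF Suc.prems(1) se(1)] colorings3D(1)[OF Suc.prems(1) se(2)]]
      by metis
    ultimately have hu: "h u = h v + s" using ne s by auto
    then have "s * h u > s * h v" using s by auto
    then have "u \<notin> P" using v(2)[of u] by auto
    then have "s * d u \<le> 0" using se by (auto simp: P_def)
    moreover have "\<bar>d u - d v\<bar> \<le> 1" using Suc.prems(2) uv by (auto simp: lift3_def lipschitz1_def)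
    ultimately have "d u = 0" "d v = s" using dv s by auto
    then have "3 dvd int (g u) - int (f u)" "3 dvd s - (int (g v) - int (f v))"
      using dm[OF se(1)] dm[OF se(2)] by (auto simp: mod_eq_dvd_iff)
    moreover have "3 dvd int (f u) - (int (f v) + s)"
      using hm[OF se(1)] hm[OF se(2)] hu by (metis mod_add_left_eq mod_eq_dvd_iff)
    ultimately have "3 dvd (int (g u) - int (f u)) + (s - (int (g v) - int (f v)))
        + (int (f u) - (int (f v) + s))" by (intro dvd_add)
    then have "int (g u) mod 3 = int (g v) mod 3" by (simp add: mod_eq_dvd_iff)
    then show False
      using colorings3D(2)[OF g uv] colour_eqI[OF colorings3D(1)[OF g se(1)] colorings3D(1)[OF g se(2)]]
      by blast
  qed
  define f' where "f' = f(v := nat ((int (f v) + s) mod 3))"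
  have f'v: "int (f' v) = (int (f v) + s) mod 3" by (simp add: f'_def)
  have f'o: "f' u = f u" if "u \<noteq> v" for u using that by (simp add: f'_def)
  have f'le: "f' v \<in> {0, 1, 2}"
  proof -
    have "0 \<le> int (f' v)" "int (f' v) < 3" unfolding f'v by simp_all
    then show ?thesis by auto
  qed
  have f'nb: "f' u \<noteq> f' v" if uv: "{u, v} \<in> E" for u
  proof
    assume eq: "f' u = f' v"
    note se = simple_graph_edgeD[OF sg uv]
    have "int (f u) mod 3 = (int (f v) + s) mod 3" using eq f'v f'o[OF se(3)] by simp
    moreover have "int (f u) mod 3 = (int (f v) - s) mod 3"
      using hm[OF se(1)] hm[OF se(2)] nb[OF uv] by (metis mod_diff_left_eq)
    ultimately have "3 dvd (int (f v) + s) - (int (f v) - s)" by (metis mod_eq_dvd_iff)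
    then show False using s by auto
  qed
  have f'col: "f' \<in> colorings3 V E"
  proof -
    have "f' \<in> V \<rightarrow>\<^sub>E {0, 1, 2}"
      using Suc.prems(1) f'le vV by (auto simp: colorings3_def f'_def PiE_def Pi_def extensional_def)
    moreover have "f' a \<noteq> f' b" if ab: "{a, b} \<in> E" for a b
    proof -
      have ba: "{b, a} \<in> E" using ab by (simp add: insert_commute)
      show ?thesis
        using f'nb[of a] f'nb[of b] f'o[of a] f'o[of b] ab ba colorings3D(2)[OF Suc.prems(1) ab]
        by metis
    qed
    ultimately show ?thesis by (simp add: colorings3_def)
  qed
  have "f' v \<noteq> f v"
  proof
    assume "f' v = f v"
    then have "int (f v) mod 3 = (int (f v) + s) mod 3" using f'v by simp
    then show False using s mod3_neq_if_diff_1[of "int (f v)" "int (f v) + s"] by auto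
  qed
  then have "{u\<in>V. f u \<noteq> f' u} = {v}" using vV f'o by fastforce
  then have step: "(f, f') \<in> col_adj V E" using Suc.prems(1) f'col by (simp add: col_adj_def)
  define e where "e = d(v := d v - s)"
  have "lipschitz1 E e"
    unfolding lipschitz1_def
  proof (intro allI impI)
    have *: "\<bar>d a - (d v - s)\<bar> \<le> 1" if av: "{a, v} \<in> E" for a
    proof -
      note se = simple_graph_edgeD[OF sg av]
      have ab: "\<bar>d a - d v\<bar> \<le> 1" using Suc.prems(2) av by (auto simp: lift3_def lipschitz1_def)
      \<comment> \<open>After lowering \<open>d v\<close> by \<open>s\<close>, this difference would
        become \<open>2 * s\<close>. It cannot occur: \<open>a\<close> has the colour
        \<open>f v - s\<close> modulo 3, so it would give \<open>g a = g v\<close>.\<close>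
      have "d a - d v \<noteq> s"
      proof
        assume A: "d a - d v = s"
        have "s mod 3 = ((int (g a) - int (f a)) - (int (g v) - int (f v))) mod 3"
          using dm[OF se(1)] dm[OF se(2)] A by (metis mod_diff_eq)
        then have "3 dvd ((int (g a) - int (f a)) - (int (g v) - int (f v))) - s"
          by (metis mod_eq_dvd_iff)
        moreover have "3 dvd int (f a) - (int (f v) - s)"
          using hm[OF se(1)] hm[OF se(2)] nb[OF av] by (metis mod_diff_left_eq mod_eq_dvd_iff)
        ultimately have "3 dvd (((int (g a) - int (f a)) - (int (g v) - int (f v))) - s)
            + (int (f a) - (int (f v) - s))" by (rule dvd_add)
        then have "int (g a) mod 3 = int (g v) mod 3" by (simp add: mod_eq_dvd_iff)
        then show False
          using colorings3D(2)[OF g av] colour_eqI[OF colorings3D(1)[OF g se(1)] colorings3D(1)[OF g se(2)]]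
          by blast
      qed
      then show ?thesis using ab s by auto
    qed
    fix a b assume ab: "{a, b} \<in> E"
    have ba: "{b, a} \<in> E" using ab by (simp add: insert_commute)
    show "\<bar>e a - e b\<bar> \<le> 1"
      using *[of a] *[of b] ab ba simple_graph_edgeD(3)[OF sg ab] lipschitz1D[of E d a b] Suc.prems(2)
      by (auto simp: e_def lift3_def abs_minus_commute)
  qed
  moreover have "e u mod 3 = (int (g u) - int (f' u)) mod 3" if "u \<in> V" for u
  proof (cases "u = v")
    case True
    have "(d v - s) mod 3 = (int (g v) - int (f v) - s) mod 3"
      using dm[OF vV] by (metis mod_diff_left_eq)
    also have "\<dots> = (int (g v) - (int (f v) + s) mod 3) mod 3"
      by (simp add: mod_diff_right_eq diff_diff_eq)
    finally show ?thesis using True f'v by (simp add: e_def)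
  next
    case False
    then show ?thesis using dm[OF that] f'o by (simp add: e_def)
  qed
  ultimately have "lift3 V E (\<lambda>u. int (g u) - int (f' u)) e" by (simp add: lift3_def)
  moreover have "(\<Sum>u\<in>V. \<bar>e u\<bar>) = int N"
  proof -
    have "(\<Sum>u\<in>V. \<bar>e u\<bar>) = (\<Sum>u\<in>V. \<bar>d u\<bar> - (if u = v then 1 else 0))"
      by (rule sum.cong) (use dv s in \<open>auto simp: e_def\<close>)
    also have "\<dots> = (\<Sum>u\<in>V. \<bar>d u\<bar>) - 1" using fin vV by (simp add: sum_subtractf)
    finally show ?thesis using Suc.prems(3) by simp
  qed
  ultimately have "(f', g) \<in> col_adj V E ^^ N" using Suc.IH f'col by blast
  then show ?case using step by (rule relpow_Suc_I2[rotated])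
qed

section \<open>The distance formula and the diameter\<close>

lemma lift3_shift: "lift3 V E \<phi> d \<Longrightarrow> lift3 V E \<phi> (\<lambda>v. d v - 3 * k)"
proof -
  have "(d v - 3 * k) mod 3 = d v mod 3" for v by presburger
  then show "lift3 V E \<phi> d \<Longrightarrow> ?thesis" by (simp add: lift3_def lipschitz1_def)
qed

text \<open>The difference of two lifts is a multiple of 3 that changes by at most 2 along an edge,
  hence is constant on a connected graph.\<close>

lemma lift3_unique:
  assumes "simple_graph V E" "connected_graph V E" "lift3 V E \<phi> d" "lift3 V E \<phi> d'"
  shows "\<exists>k. \<forall>v\<in>V. d' v = d v - 3 * k"
proof -
  obtain r where r: "r \<in> V" using assms(2) by (auto simp: connected_graph_def)
  have m: "3 dvd d v - d' v" if "v \<in> V" for v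
    using assms(3,4) that unfolding lift3_def by (metis mod_eq_dvd_iff)
  have "d v - d' v = d r - d' r" if v: "v \<in> V" for v
  proof (rule ccontr)
    assume "d v - d' v \<noteq> d r - d' r"
    then obtain a b where ab: "a \<in> V" "b \<in> V" "{a, b} \<in> E"
        "d a - d' a = d r - d' r" "d b - d' b \<noteq> d r - d' r"
      using connected_crossing[OF assms(1,2) r v, of "\<lambda>x. d x - d' x = d r - d' r"] by auto
    have "\<bar>d a - d b\<bar> \<le> 1" "\<bar>d' a - d' b\<bar> \<le> 1"
      using assms(3,4) ab(3) by (auto simp: lift3_def lipschitz1_def)
    moreover obtain i j where "d a - d' a = 3 * i" "d b - d' b = 3 * j"
      using m[OF ab(1)] m[OF ab(2)] by (auto simp: dvd_def)
    moreover have "i \<noteq> j" using ab(4,5) calculation by auto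
    ultimately show False by arith
  qed
  moreover obtain k where "d r - d' r = 3 * k" using m[OF r] by (auto simp: dvd_def)
  ultimately have "\<forall>v\<in>V. d' v = d v - 3 * k" by (smt (verit))
  then show ?thesis by blast
qed

lemma col_dist_le_offset_cost:
  assumes "grown_tree V E" "f \<in> colorings3 V E" "g \<in> colorings3 V E"
    and "lift3 V E (\<lambda>v. int (g v) - int (f v)) d"
  shows "int (col_dist V E f g) \<le> offset_cost V d k"
proof -
  have ge: "offset_cost V d k \<ge> 0" by (simp add: offset_cost_def sum_nonneg)
  have "(f, g) \<in> col_adj V E ^^ nat (offset_cost V d k)"
    by (rule lift_gives_walk[OF assms(1,3,2) lift3_shift[OF assms(4), of k]])
       (use ge in \<open>simp add: offset_cost_def\<close>)
  then have "col_dist V E f g \<le> nat (offset_cost V d k)"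
    unfolding col_dist_def by (rule Least_le)
  then show ?thesis using ge by linarith
qed

lemma col_dist_ge_offset_cost:
  assumes "grown_tree V E" "f \<in> colorings3 V E" "g \<in> colorings3 V E"
    and "lift3 V E (\<lambda>v. int (g v) - int (f v)) d"
  shows "\<exists>k. offset_cost V d k \<le> int (col_dist V E f g)"
proof -
  note sg = grown_tree_simple[OF assms(1)]
  \<comment> \<open>The \<open>LEAST\<close> in \<open>col_dist\<close> is an attained length only
    because some walk exists.\<close>
  have "(f, g) \<in> col_adj V E ^^ nat (offset_cost V d 0)"
    by (rule lift_gives_walk[OF assms(1,3,2) assms(4)]) (simp add: offset_cost_def sum_nonneg)
  then have "(f, g) \<in> col_adj V E ^^ col_dist V E f g"
    unfolding col_dist_def by (rule LeastI)
  then obtain d' where d': "lift3 V E (\<lambda>v. int (g v) - int (f v)) d'"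
      "(\<Sum>v\<in>V. \<bar>d' v\<bar>) \<le> int (col_dist V E f g)"
    using walk_gives_lift[OF sg assms(2)] by blast
  obtain k where "\<forall>v\<in>V. d' v = d v - 3 * k"
    using lift3_unique[OF sg grown_tree_connected[OF assms(1)] assms(4) d'(1)] by blast
  then have "offset_cost V d k = (\<Sum>v\<in>V. \<bar>d' v\<bar>)" by (simp add: offset_cost_def)
  then show ?thesis using d'(2) by metis
qed

lemma finite_col_dists:
  assumes "finite V"
  shows "finite {col_dist V E f g | f g. f \<in> colorings3 V E \<and> g \<in> colorings3 V E}"
proof -
  have "{col_dist V E f g | f g. f \<in> colorings3 V E \<and> g \<in> colorings3 V E} =
      (\<lambda>(f, g). col_dist V E f g) ` (colorings3 V E \<times> colorings3 V E)" by auto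
  then show ?thesis using finite_colorings3[OF assms] by simp
qed

text \<open>Every 1-Lipschitz map arises: with \<open>b\<close> a bipartition and \<open>t = (b + d) mod 2\<close>, the maps
  \<open>d + t\<close> and \<open>t - d\<close> change by exactly 1 along every edge, and their difference is \<open>2 * d\<close>.\<close>

lemma lipschitz_is_lift:
  assumes T: "grown_tree V E" and d: "lipschitz1 E d"
  shows "\<exists>f\<in>colorings3 V E. \<exists>g\<in>colorings3 V E. lift3 V E (\<lambda>v. int (g v) - int (f v)) d"
proof -
  obtain b :: "'a \<Rightarrow> bool" where b: "\<And>u v. {u, v} \<in> E \<Longrightarrow> b u \<noteq> b v"
    using grown_tree_bipartite[OF T] by blast
  define t :: "'a \<Rightarrow> int" where "t = (\<lambda>v. ((if b v then 1 else 0) + d v) mod 2)"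
  define f where "f = restrict (\<lambda>v. nat ((d v + t v) mod 3)) V"
  define g where "g = restrict (\<lambda>v. nat ((t v - d v) mod 3)) V"
  note sg = grown_tree_simple[OF T]
  have rng: "nat (x mod 3) \<in> {0, 1, 2}" for x :: int
  proof -
    have "0 \<le> x mod 3" "x mod 3 < 3" by simp_all
    then show ?thesis by auto
  qed
  have fv: "int (f v) = (d v + t v) mod 3" and gv: "int (g v) = (t v - d v) mod 3" if "v \<in> V" for v
    using that by (simp_all add: f_def g_def)
  have proper: "f u \<noteq> f v \<and> g u \<noteq> g v" if uv: "{u, v} \<in> E" for u v
  proof -
    note se = simple_graph_edgeD[OF sg uv]
    have ab: "\<bar>d u - d v\<bar> \<le> 1" using d uv by (rule lipschitz1D)
    have tt: "(d u = d v \<and> \<bar>t u - t v\<bar> = 1) \<or> (\<bar>d u - d v\<bar> = 1 \<and> t u = t v)"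
    proof (cases "d u = d v")
      case True
      have "\<bar>t u - t v\<bar> = 1" unfolding t_def using True b[OF uv] by (cases "b u"; cases "b v"; simp; presburger)
      then show ?thesis using True by simp
    next
      case False
      then have "d u = d v + 1 \<or> d u = d v - 1" using ab by auto
      then have "t u = t v" unfolding t_def using b[OF uv]
        by (cases "b u"; cases "b v"; simp; presburger)
      then show ?thesis using False ab by auto
    qed
    have "(d u + t u) mod 3 \<noteq> (d v + t v) mod 3" "(t u - d u) mod 3 \<noteq> (t v - d v) mod 3"
      using tt by (auto intro!: mod3_neq_if_diff_1 simp: abs_if split: if_splits)
    then show ?thesis using fv[OF se(1)] fv[OF se(2)] gv[OF se(1)] gv[OF se(2)] by metis
  qed
  have "f \<in> colorings3 V E" "g \<in> colorings3 V E"
    using proper rng by (auto simp: colorings3_def f_def g_def restrict_PiE_iff simp del: insert_iff)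
  moreover have "d v mod 3 = (int (g v) - int (f v)) mod 3" if "v \<in> V" for v
  proof -
    \<comment> \<open>The order of subtraction matters: modulo 3, \<open>g - f\<close> is
      \<open>- 2 * d\<close>, which is \<open>d\<close>.\<close>
    have "(int (g v) - int (f v)) mod 3 = ((t v - d v) - (d v + t v)) mod 3"
      unfolding fv[OF that] gv[OF that] by (rule mod_diff_eq)
    also have "\<dots> = (d v + 3 * (- d v)) mod 3" by (simp add: algebra_simps)
    also have "\<dots> = d v mod 3" by (rule mod_mult_self2)
    finally show ?thesis by simp
  qed
  ultimately show ?thesis using d unfolding lift3_def by blast
qed

lemma diam_C3_ge:
  assumes "grown_tree V E" "lipschitz1 E d" "\<And>k. int m \<le> offset_cost V d k"
  shows "m \<le> diam_C3 V E"
proof -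
  obtain f g where fg: "f \<in> colorings3 V E" "g \<in> colorings3 V E"
      "lift3 V E (\<lambda>v. int (g v) - int (f v)) d"
    using lipschitz_is_lift[OF assms(1,2)] by blast
  have "int m \<le> int (col_dist V E f g)"
    using col_dist_ge_offset_cost[OF assms(1) fg] assms(3) by (meson order_trans)
  moreover have "col_dist V E f g \<le> diam_C3 V E"
    unfolding diam_C3_def
    by (intro Max_ge finite_col_dists simple_graph_finite[OF grown_tree_simple[OF assms(1)]])
       (use fg in auto)
  ultimately show ?thesis by linarith
qed

lemma diam_C3_attained:
  assumes "grown_tree V E"
  shows "\<exists>d. lipschitz1 E d \<and> (\<forall>k. int (diam_C3 V E) \<le> offset_cost V d k)"
proof -
  \<comment> \<open>The zero map yields a colouring, so that \<open>Max\<close> ranges over a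
    nonempty set.\<close>
  have "lipschitz1 E (\<lambda>_. 0)" by (simp add: lipschitz1_def)
  then have "colorings3 V E \<noteq> {}" using lipschitz_is_lift[OF assms] by blast
  then have "diam_C3 V E \<in> {col_dist V E f g | f g. f \<in> colorings3 V E \<and> g \<in> colorings3 V E}"
    unfolding diam_C3_def
    by (intro Max_in finite_col_dists simple_graph_finite[OF grown_tree_simple[OF assms]]) blast
  then obtain f g where fg: "f \<in> colorings3 V E" "g \<in> colorings3 V E"
      "diam_C3 V E = col_dist V E f g" by blast
  obtain d where "lift3 V E (\<lambda>v. int (g v) - int (f v)) d" using grown_tree_lift[OF assms] by blast
  then show ?thesis using col_dist_le_offset_cost[OF assms fg(1,2)] fg(3) by (auto simp: lift3_def)
qed

section \<open>The maximum\<close>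

lemma lipschitz1_ivt:
  assumes "simple_graph V E" "connected_graph V E" "lipschitz1 E d"
    and "u \<in> V" "w \<in> V" "d u \<le> c" "c \<le> d w"
  shows "\<exists>v\<in>V. d v = c"
proof (cases "d w = c")
  case False
  then have "\<not> d w \<le> c" using assms(7) by simp
  then obtain a b where "a \<in> V" "{a, b} \<in> E" "d a \<le> c" "\<not> d b \<le> c"
    using connected_crossing[OF assms(1,2,4,5), of "\<lambda>x. d x \<le> c"] assms(6) by blast
  moreover have "\<bar>d a - d b\<bar> \<le> 1" using assms(3) calculation(2) by (rule lipschitz1D)
  ultimately have "a \<in> V \<and> d a = c" by auto
  then show ?thesis by blast
qed (use assms in blast)

text \<open>All values from 0 to the maximum are taken, so the maximum is at most
  \<open>card X - 1\<close>; removing a vertex of maximal value leaves a gap-free family, and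
  induction applies. Equality forces the maximum to be \<open>card X - 1\<close>, so that
  \<open>card X\<close> different values occur.\<close>

lemma sum_gap_free_le_triangular:
  fixes e :: "'a \<Rightarrow> int"
  assumes "finite X" "\<And>x. x \<in> X \<Longrightarrow> 0 \<le> e x"
    and "\<And>x j. x \<in> X \<Longrightarrow> 0 \<le> j \<Longrightarrow> j \<le> e x \<Longrightarrow> \<exists>x'\<in>X. e x' = j"
  shows "2 * (\<Sum>x\<in>X. e x) \<le> int (card X) * (int (card X) - 1) \<and>
    (2 * (\<Sum>x\<in>X. e x) = int (card X) * (int (card X) - 1) \<longrightarrow> inj_on e X)"
  using assms
proof (induction "card X" arbitrary: X)
  case 0
  then show ?case by simp
next
  case (Suc m)
  have "X \<noteq> {}" using Suc.hyps(2) by auto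
  then obtain x where x: "x \<in> X" "\<And>y. y \<in> X \<Longrightarrow> e y \<le> e x"
    using finite_ex_max[OF Suc.prems(1), of e] by blast
  define Y where "Y = X - {x}"
  have cY: "m = card Y" using Suc.hyps(2) x(1) Suc.prems(1) by (simp add: Y_def)
  define tY where "tY = int (card Y) * (int (card Y) - 1)"
  define S where "S = (\<Sum>x\<in>Y. e x)"
  have IH: "2 * S \<le> tY" unfolding tY_def S_def
  proof (rule conjunct1[OF Suc.hyps(1)[OF cY]])
    show "finite Y" "\<And>y. y \<in> Y \<Longrightarrow> 0 \<le> e y" using Suc.prems by (auto simp: Y_def)
    fix y j assume y: "y \<in> Y" and j: "0 \<le> j" "j \<le> e y"
    obtain x' where x': "x' \<in> X" "e x' = j" using Suc.prems(3) y j by (auto simp: Y_def)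
    show "\<exists>x'\<in>Y. e x' = j"
    \<comment> \<open>If the witness is the removed maximum, then
      \<open>e y \<le> e x = j \<le> e y\<close>, so \<open>y\<close> can replace it.\<close>
    proof (cases "x' = x")
      case True
      then have "e y = j" using x(2)[of y] y j x'(2) by (auto simp: Y_def)
      then show ?thesis using y by blast
    next
      case False
      then show ?thesis using x' by (auto simp: Y_def)
    qed
  qed
  have sumX: "(\<Sum>x\<in>X. e x) = e x + S"
    unfolding S_def Y_def using x(1) Suc.prems(1) by (rule sum.remove[rotated])
  have "{0..e x} \<subseteq> e ` X" using Suc.prems(3)[OF x(1)] by (fastforce simp: image_iff)
  then have "card {0..e x} \<le> card (e ` X)" using Suc.prems(1) by (intro card_mono) auto
  then have img: "e x + 1 \<le> int (card (e ` X))" using Suc.prems(2)[OF x(1)] by simp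
  have le: "card (e ` X) \<le> Suc m" using card_image_le[OF Suc.prems(1), of e] Suc.hyps(2) by simp
  have tri: "int (card X) * (int (card X) - 1) = 2 * int m + tY"
    unfolding tY_def Suc.hyps(2)[symmetric] cY[symmetric] by (simp add: algebra_simps)
  have "e x \<le> int m" using img le by linarith
  then have 1: "2 * (\<Sum>x\<in>X. e x) \<le> int (card X) * (int (card X) - 1)"
    unfolding tri sumX using IH by simp
  have "inj_on e X" if eq: "2 * (\<Sum>x\<in>X. e x) = int (card X) * (int (card X) - 1)"
  proof (rule eq_card_imp_inj_on[OF Suc.prems(1)])
    have "e x \<ge> int m" using eq IH unfolding tri sumX by simp
    then show "card (e ` X) = card X" using img le Suc.hyps(2) by linarith
  qed
  then show ?case using 1 by blast
qed

text \<open>The vertex \<open>w\<close> above \<open>c\<close> makes every value from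
  \<open>d x\<close> up to \<open>c\<close> occur, so the deviations below \<open>c\<close> are
  gap-free.\<close>

lemma sum_below_le_triangular:
  assumes "simple_graph V E" "connected_graph V E" "lipschitz1 E d" "w \<in> V" "d w > c"
  defines "p \<equiv> int (card {v\<in>V. d v \<le> c})"
  shows "2 * (\<Sum>v\<in>V. max 0 (c - d v)) \<le> p * (p - 1)"
    and "2 * (\<Sum>v\<in>V. max 0 (c - d v)) = p * (p - 1) \<Longrightarrow> inj_on d {v\<in>V. d v \<le> c}"
proof -
  let ?A = "{v\<in>V. d v \<le> c}"
  have fin: "finite V" using assms(1) by (rule simple_graph_finite)
  have eq: "(\<Sum>v\<in>V. max 0 (c - d v)) = (\<Sum>v\<in>?A. c - d v)"
    unfolding sum.inter_filter[OF fin] by (rule sum.cong) auto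
  have main: "2 * (\<Sum>v\<in>?A. c - d v) \<le> int (card ?A) * (int (card ?A) - 1) \<and>
    (2 * (\<Sum>v\<in>?A. c - d v) = int (card ?A) * (int (card ?A) - 1) \<longrightarrow> inj_on (\<lambda>v. c - d v) ?A)"
  proof (rule sum_gap_free_le_triangular)
    fix x j assume x: "x \<in> ?A" and j: "0 \<le> j" "j \<le> c - d x"
    then obtain v where "v \<in> V" "d v = c - j"
      using lipschitz1_ivt[OF assms(1,2,3), of x w "c - j"] assms(4,5) by auto
    then show "\<exists>x'\<in>?A. c - d x' = j" using j by auto
  qed (use fin in auto)
  show "2 * (\<Sum>v\<in>V. max 0 (c - d v)) \<le> p * (p - 1)" using main unfolding eq p_def by simp
  show "inj_on d ?A" if "2 * (\<Sum>v\<in>V. max 0 (c - d v)) = p * (p - 1)"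
    using main that unfolding eq p_def by (auto simp: inj_on_def)
qed

lemma lipschitz1_uminus: "lipschitz1 E d \<Longrightarrow> lipschitz1 E (\<lambda>v. - d v)"
  by (auto simp: lipschitz1_def abs_minus_commute)

lemma sum_above_le_triangular:
  assumes "simple_graph V E" "connected_graph V E" "lipschitz1 E d" "w \<in> V" "d w < c"
  defines "q \<equiv> int (card {v\<in>V. d v \<ge> c})"
  shows "2 * (\<Sum>v\<in>V. max 0 (d v - c)) \<le> q * (q - 1)"
    and "2 * (\<Sum>v\<in>V. max 0 (d v - c)) = q * (q - 1) \<Longrightarrow> inj_on d {v\<in>V. d v \<ge> c}"
  using sum_below_le_triangular[OF assms(1,2) lipschitz1_uminus[OF assms(3)] assms(4), of "- c"] assms(5)
  unfolding q_def by (simp_all add: add.commute inj_on_def)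

lemma sum_indicator_int: "finite V \<Longrightarrow> (\<Sum>v\<in>V. if P v then 1 else 0 :: int) = int (card {v\<in>V. P v})"
  by (simp add: sum.If_cases Int_def)

lemma card_filter_compl:
  assumes "finite V"
  shows "card {v\<in>V. P v} + card {v\<in>V. \<not> P v} = card V"
proof -
  have "card ({v\<in>V. P v} \<union> {v\<in>V. \<not> P v}) = card {v\<in>V. P v} + card {v\<in>V. \<not> P v}"
    by (rule card_Un_disjoint) (use assms in auto)
  moreover have "{v\<in>V. P v} \<union> {v\<in>V. \<not> P v} = V" by auto
  ultimately show ?thesis by simp
qed

text \<open>Vertices at \<open>3 * k\<close> itself count as lower ones. The upper deviations are
  triangular when measured from \<open>3 * k + 1\<close>, and measuring from \<open>3 * k\<close>
  adds 1 for each of the \<open>q\<close> vertices, which turns \<open>q * (q - 1)\<close> into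
  \<open>q * (q + 1)\<close>. In the equality case \<open>d\<close> is injective on both parts, and
  the parts share no value.\<close>

lemma offset_cost_le_split:
  fixes k :: int
  assumes "simple_graph V E" "connected_graph V E" "lipschitz1 E d"
  defines "p \<equiv> int (card {v\<in>V. d v \<le> 3 * k})"
  defines "q \<equiv> int (card {v\<in>V. \<not> d v \<le> 3 * k})"
  assumes "p > 0" "q > 0"
  shows "2 * offset_cost V d k \<le> p * (p - 1) + q * (q + 1)"
    and "2 * offset_cost V d k = p * (p - 1) + q * (q + 1) \<Longrightarrow> inj_on d V"
proof -
  have fin: "finite V" using assms(1) by (rule simple_graph_finite)
  have "{v\<in>V. d v \<le> 3 * k} \<noteq> {}" "{v\<in>V. \<not> d v \<le> 3 * k} \<noteq> {}"
    using assms(6,7) unfolding p_def q_def by (metis card.empty less_irrefl of_nat_0)+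
  then obtain a b where ab: "a \<in> V" "d a < 3 * k + 1" "b \<in> V" "d b > 3 * k" by fastforce
  have qe: "q = int (card {v\<in>V. d v \<ge> 3 * k + 1})" unfolding q_def
    by (rule arg_cong[of _ _ "\<lambda>S. int (card S)"]) auto
  note lo = sum_below_le_triangular[OF assms(1-3) ab(3,4), folded p_def]
  note hi = sum_above_le_triangular[OF assms(1-3) ab(1,2), folded qe]
  have "offset_cost V d k = (\<Sum>v\<in>V. max 0 (3 * k - d v) + max 0 (d v - (3 * k + 1)) +
      (if \<not> d v \<le> 3 * k then 1 else 0))"
    unfolding offset_cost_def by (rule sum.cong) auto
  also have "\<dots> = (\<Sum>v\<in>V. max 0 (3 * k - d v)) + (\<Sum>v\<in>V. max 0 (d v - (3 * k + 1))) + q"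
    unfolding q_def sum.distrib sum_indicator_int[OF fin] ..
  finally have eq: "offset_cost V d k = \<dots>" .
  show "2 * offset_cost V d k \<le> p * (p - 1) + q * (q + 1)"
    using lo(1) hi(1) unfolding eq by (simp add: algebra_simps)
  assume "2 * offset_cost V d k = p * (p - 1) + q * (q + 1)"
  then have "2 * (\<Sum>v\<in>V. max 0 (3 * k - d v)) = p * (p - 1)"
      "2 * (\<Sum>v\<in>V. max 0 (d v - (3 * k + 1))) = q * (q - 1)"
    using lo(1) hi(1) unfolding eq by (simp_all add: algebra_simps)
  then have "inj_on d {v\<in>V. d v \<le> 3 * k}" "inj_on d {v\<in>V. d v \<ge> 3 * k + 1}"
    using lo(2) hi(2) by blast+
  then show "inj_on d V" unfolding inj_on_def
    by (smt (verit, best) mem_Collect_eq)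
qed

lemma offset_cost_uminus: "offset_cost V (\<lambda>v. - d v) (- k) = offset_cost V d k"
  unfolding offset_cost_def by (rule sum.cong) auto

lemma offset_cost_le_split_flipped:
  fixes k :: int
  assumes "simple_graph V E" "connected_graph V E" "lipschitz1 E d"
  defines "p \<equiv> int (card {v\<in>V. d v \<ge> 3 * k})"
  defines "q \<equiv> int (card {v\<in>V. \<not> d v \<ge> 3 * k})"
  assumes "p > 0" "q > 0"
  shows "2 * offset_cost V d k \<le> p * (p - 1) + q * (q + 1)"
    and "2 * offset_cost V d k = p * (p - 1) + q * (q + 1) \<Longrightarrow> inj_on d V"
  using offset_cost_le_split[OF assms(1,2) lipschitz1_uminus[OF assms(3)], of "- k"]
    assms(6,7) offset_cost_uminus[of V d k]
  unfolding p_def q_def by (simp_all add: inj_on_def)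

text \<open>With \<open>p + q\<close> fixed, the left side is a convex quadratic in \<open>p\<close>
  that takes the right-hand value at both \<open>p = L\<close> and \<open>p = U\<close>; the gap is
  \<open>2 * (p - L) * (U - p)\<close>.\<close>

lemma split_value_le:
  fixes L U p q :: int
  assumes "L \<le> p" "p \<le> U" "p + q + 1 = L + U"
  shows "p * (p - 1) + q * (q + 1) \<le> L * (L - 1) + U * (U - 1)"
proof -
  have q: "q = L + U - 1 - p" using assms(3) by simp
  have "0 \<le> (p - L) * (U - p)" using assms by simp
  then show ?thesis unfolding q by (simp add: algebra_simps)
qed

lemma consecutive_prod_mono:
  fixes a b :: int
  assumes "0 \<le> a" "a \<le> b" "1 \<le> b"
  shows "a * (a - 1) \<le> b * (b - 1)"
proof (cases "a = 0")
  case False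
  then show ?thesis using assms by (intro mult_mono) auto
qed (use assms in auto)

text \<open>The cut at 3 is the first with at least \<open>L\<close> vertices at or below it. If
  this count or its mirror image lies in the window from \<open>L\<close> to \<open>U\<close>, the
  split bound applies; otherwise the window is jumped over, and there is slack to spare.\<close>

lemma offset_cost_le_path_centred:
  assumes sg: "simple_graph V E" and cg: "connected_graph V E" and lip: "lipschitz1 E d"
    and n: "int (card V) + 1 = L + U" "L \<ge> 3" "L + 2 \<le> U" "U \<le> L + 3"
    and lo: "int (card {v\<in>V. d v \<le> 0}) < L" and hi: "L \<le> int (card {v\<in>V. d v \<le> 3})"
  shows "\<exists>k. 2 * offset_cost V d k \<le> L * (L - 1) + U * (U - 1) \<and>
    (2 * offset_cost V d k = L * (L - 1) + U * (U - 1) \<longrightarrow> inj_on d V)"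
proof -
  have fin: "finite V" using sg by (rule simple_graph_finite)
  define N where "N = L * (L - 1) + U * (U - 1)"
  define P where "P = int (card {v\<in>V. d v \<le> 3})"
  define Q where "Q = int (card {v\<in>V. \<not> d v \<le> 3})"
  define r where "r = int (card {v\<in>V. d v \<ge> 3})"
  define a where "a = int (card {v\<in>V. \<not> d v \<ge> 3})"
  define p where "p = int (card {v\<in>V. d v \<le> 0})"
  have PQ: "P + Q = int (card V)" unfolding P_def Q_def
    using card_filter_compl[OF fin, of "\<lambda>v. d v \<le> 3"] by linarith
  have ra: "r + a = int (card V)" unfolding r_def a_def
    using card_filter_compl[OF fin, of "\<lambda>v. d v \<ge> 3"] by linarith
  have p0: "p + int (card {v\<in>V. \<not> d v \<le> 0}) = int (card V)" unfolding p_def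
    using card_filter_compl[OF fin, of "\<lambda>v. d v \<le> 0"] by linarith
  have nn: "P \<ge> 0" "Q \<ge> 0" "r \<ge> 0" "a \<ge> 0" "p \<ge> 0"
    by (simp_all add: P_def Q_def r_def a_def p_def)
  consider "P \<le> U" | "P > U" "L \<le> r" "r \<le> U" | "P > U" "r > U" | "P > U" "r < L" by linarith
  then have "\<exists>k. 2 * offset_cost V d k \<le> N \<and> (2 * offset_cost V d k = N \<longrightarrow> inj_on d V)"
  proof cases
    case 1
    have pos: "P > 0" "Q > 0" using 1 hi n PQ by (auto simp: P_def)
    have le: "P * (P - 1) + Q * (Q + 1) \<le> N" unfolding N_def
      by (rule split_value_le) (use 1 hi n PQ in \<open>auto simp: P_def\<close>)
    have "2 * offset_cost V d 1 \<le> P * (P - 1) + Q * (Q + 1)"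
        "2 * offset_cost V d 1 = P * (P - 1) + Q * (Q + 1) \<Longrightarrow> inj_on d V"
      using offset_cost_le_split[OF sg cg lip, of 1] pos unfolding P_def Q_def by simp_all
    then show ?thesis using le by (intro exI[of _ 1]) linarith
  next
    case 2
    have pos: "r > 0" "a > 0" using 2 n ra by auto
    have le: "r * (r - 1) + a * (a + 1) \<le> N" unfolding N_def
      by (rule split_value_le) (use 2 n ra in auto)
    have "2 * offset_cost V d 1 \<le> r * (r - 1) + a * (a + 1)"
        "2 * offset_cost V d 1 = r * (r - 1) + a * (a + 1) \<Longrightarrow> inj_on d V"
      using offset_cost_le_split_flipped[OF sg cg lip, of 1] pos unfolding r_def a_def by simp_all
    then show ?thesis using le by (intro exI[of _ 1]) linarith
  next
    \<comment> \<open>So many vertices carry the value 3 that fewer than \<open>L - 1\<close> lie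
      strictly on either side of it. Centring at 3 is then strictly cheaper than the bound.\<close>
    case 3
    have "{v\<in>V. d v \<ge> 3} \<noteq> {}" "{v\<in>V. d v \<le> 3} \<noteq> {}"
      using 3 n unfolding P_def r_def by (auto simp del: Collect_empty_eq)
    then obtain w z where wz: "w \<in> V" "d w > 2" "z \<in> V" "d z < 4" by fastforce
    have ae: "a = int (card {v\<in>V. d v \<le> 2})" unfolding a_def
      by (rule arg_cong[of _ _ "\<lambda>S. int (card S)"]) auto
    have Qe: "Q = int (card {v\<in>V. d v \<ge> 4})" unfolding Q_def
      by (rule arg_cong[of _ _ "\<lambda>S. int (card S)"]) auto
    note bl = sum_below_le_triangular(1)[OF sg cg lip wz(1,2), folded ae]
    note ab = sum_above_le_triangular(1)[OF sg cg lip wz(3,4), folded Qe]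
    have "offset_cost V d 1 = (\<Sum>v\<in>V. max 0 (2 - d v) + max 0 (d v - 4) +
        (if \<not> d v \<ge> 3 then 1 else 0) + (if \<not> d v \<le> 3 then 1 else 0))"
      unfolding offset_cost_def by (rule sum.cong) auto
    also have "\<dots> = (\<Sum>v\<in>V. max 0 (2 - d v)) + (\<Sum>v\<in>V. max 0 (d v - 4)) + a + Q"
      unfolding a_def Q_def sum.distrib sum_indicator_int[OF fin] ..
    finally have "2 * offset_cost V d 1 \<le> a * (a - 1) + Q * (Q - 1) + 2 * a + 2 * Q"
      using bl ab by linarith
    also have "\<dots> = (a + 1) * (a + 1 - 1) + (Q + 1) * (Q + 1 - 1)" by (simp add: algebra_simps)
    also have "\<dots> \<le> (L - 1) * (L - 1 - 1) + (L - 1) * (L - 1 - 1)"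
      by (intro add_mono consecutive_prod_mono) (use 3 n PQ ra nn in auto)
    also have "\<dots> < L * (L - 1) + L * (L - 1)"
      using n(2) by (simp add: algebra_simps)
    also have "\<dots> \<le> N" unfolding N_def
      by (intro add_mono consecutive_prod_mono order_refl) (use n in auto)
    finally show ?thesis by (intro exI[of _ 1]) simp
  next
    \<comment> \<open>Fewer than \<open>L\<close> vertices lie at or below 0, and fewer than
      \<open>L\<close> at or above 3. The costs at 0 and 3 are averaged: a vertex in between adds 3
      to their sum, one outside adds 3 plus twice its excess.\<close>
    case 4
    have "{v\<in>V. \<not> d v \<le> 0} \<noteq> {}" "{v\<in>V. \<not> d v \<ge> 3} \<noteq> {}"
      using 4 n lo p0 ra unfolding p_def a_def by (auto simp del: Collect_empty_eq)
    then obtain w z where wz: "w \<in> V" "d w > 0" "z \<in> V" "d z < 3" by fastforce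
    note bl = sum_below_le_triangular(1)[OF sg cg lip wz(1,2), folded p_def]
    note ab = sum_above_le_triangular(1)[OF sg cg lip wz(3,4), folded r_def]
    have "offset_cost V d 0 + offset_cost V d 1 = (\<Sum>v\<in>V. 3 + 2 * max 0 (0 - d v) + 2 * max 0 (d v - 3))"
      unfolding offset_cost_def sum.distrib[symmetric] by (rule sum.cong) (auto simp: max_def)
    also have "\<dots> = 3 * int (card V) + 2 * (\<Sum>v\<in>V. max 0 (0 - d v)) + 2 * (\<Sum>v\<in>V. max 0 (d v - 3))"
      unfolding sum.distrib sum_distrib_left by simp
    also have "\<dots> \<le> 3 * int (card V) + p * (p - 1) + r * (r - 1)" using bl ab by linarith
    also have "\<dots> \<le> 3 * int (card V) + (L - 1) * (L - 1 - 1) + (L - 1) * (L - 1 - 1)"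
      by (intro add_mono consecutive_prod_mono order_refl) (use 4 n lo nn in \<open>auto simp: p_def\<close>)
    \<comment> \<open>For \<open>U = L + 2\<close> this amounts to \<open>2 * L > 5\<close>, for
      \<open>U = L + 3\<close> to \<open>4 * L > 4\<close>.\<close>
    also have "\<dots> < N"
    proof -
      have cV: "int (card V) = L + U - 1" using n(1) by simp
      have "U = L + 2 \<or> U = L + 3" using n by linarith
      then show ?thesis unfolding N_def cV using n(2) by (elim disjE) (simp_all add: algebra_simps)
    qed
    finally have "2 * offset_cost V d 0 < N \<or> 2 * offset_cost V d 1 < N" by linarith
    then show ?thesis by (metis less_imp_le less_irrefl)
  qed
  then show ?thesis unfolding N_def .
qed

lemma offset_cost_shift: "offset_cost V (\<lambda>v. d v - 3 * j) k = offset_cost V d (k + j)"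
  unfolding offset_cost_def by (rule sum.cong) (auto simp: algebra_simps)

lemma offset_cost_le_path:
  assumes sg: "simple_graph V E" and cg: "connected_graph V E" and lip: "lipschitz1 E d"
    and n: "int (card V) + 1 = L + U" "L \<ge> 3" "L + 2 \<le> U" "U \<le> L + 3"
  shows "\<exists>k. 2 * offset_cost V d k \<le> L * (L - 1) + U * (U - 1) \<and>
    (2 * offset_cost V d k = L * (L - 1) + U * (U - 1) \<longrightarrow> inj_on d V)"
proof -
  have fin: "finite V" using sg by (rule simple_graph_finite)
  define B where "B = (\<Sum>v\<in>V. \<bar>d v\<bar>)"
  have B: "\<bar>d v\<bar> \<le> B" if "v \<in> V" for v
    unfolding B_def by (rule member_le_sum) (use fin that in auto)
  have B0: "B \<ge> 0" by (simp add: B_def sum_nonneg)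
  \<comment> \<open>Cuts at multiples of 3 are indexed by naturals so that a least one exists: the
    cut for 0 lies below all values, the one for \<open>2 * B + 1\<close> is at \<open>3 * B\<close>
    and has all values at or below it.\<close>
  define P where "P t = int (card {v\<in>V. d v \<le> 3 * (int t - B - 1)})" for t
  have "{v\<in>V. d v \<le> 3 * (int 0 - B - 1)} = {}" using B B0 by fastforce
  then have P0: "P 0 = 0" unfolding P_def by (metis card.empty of_nat_0)
  have "{v\<in>V. d v \<le> 3 * (int (nat (2 * B + 1)) - B - 1)} = V" using B B0 by fastforce
  then have "P (nat (2 * B + 1)) = int (card V)" unfolding P_def by metis
  then have ex: "L \<le> P (nat (2 * B + 1))" using n by linarith
  define t where "t = (LEAST t. L \<le> P t)"
  have Pt: "L \<le> P t" unfolding t_def using ex by (rule LeastI)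
  then obtain s where s: "t = Suc s" using P0 n(2) by (cases t) auto
  have Ps: "P s < L" using not_less_Least[of s "\<lambda>t. L \<le> P t"] s unfolding t_def by auto
  define j where "j = int s - B - 1"
  define e where "e = (\<lambda>v. d v - 3 * j)"
  have "lipschitz1 E e" using lip by (simp add: lipschitz1_def e_def)
  moreover have "{v\<in>V. e v \<le> 0} = {v\<in>V. d v \<le> 3 * (int s - B - 1)}"
    "{v\<in>V. e v \<le> 3} = {v\<in>V. d v \<le> 3 * (int t - B - 1)}"
    unfolding e_def j_def s by auto
  ultimately have "\<exists>k. 2 * offset_cost V e k \<le> L * (L - 1) + U * (U - 1) \<and>
      (2 * offset_cost V e k = L * (L - 1) + U * (U - 1) \<longrightarrow> inj_on e V)"
    using offset_cost_le_path_centred[OF sg cg _ n, of e] Ps Pt unfolding P_def by simp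
  moreover have "inj_on e V \<Longrightarrow> inj_on d V" by (auto simp: inj_on_def e_def)
  ultimately show ?thesis using offset_cost_shift[of V d j] unfolding e_def by metis
qed

text \<open>Injectivity makes the values an interval with one vertex each, so edges join consecutive
  values. Conversely, connectedness forces an edge across each gap, and only the two vertices at
  that gap can be its ends.\<close>

lemma inj_lipschitz1_path:
  assumes sg: "simple_graph V E" and cg: "connected_graph V E" and lip: "lipschitz1 E d"
    and inj: "inj_on d V" and n: "card V = n"
  shows "graph_iso V E (path_V n) (path_E n)"
proof -
  have fin: "finite V" using sg by (rule simple_graph_finite)
  have ne: "V \<noteq> {}" using cg by (simp add: connected_graph_def)
  define lo where "lo = Min (d ` V)"
  define hi where "hi = Max (d ` V)"
  have rng: "lo \<le> d v" "d v \<le> hi" if "v \<in> V" for v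
    using fin that by (auto simp: lo_def hi_def)
  have "lo \<in> d ` V" "hi \<in> d ` V" unfolding lo_def hi_def using fin ne by (auto intro!: Min_in Max_in)
  then obtain u w where uw: "u \<in> V" "w \<in> V" "d u = lo" "d w = hi" by auto
  have img: "d ` V = {lo..hi}"
  proof
    show "{lo..hi} \<subseteq> d ` V"
      using lipschitz1_ivt[OF sg cg lip uw(1,2)] uw(3,4) by (auto simp: image_iff) metis
  qed (use rng in auto)
  have "card (d ` V) = n" using inj n by (simp add: card_image)
  then have hi: "hi + 1 - lo = int n" using img rng[OF uw(1)] by simp
  define f where "f v = nat (d v - lo)" for v
  have f: "int (f v) = d v - lo" if "v \<in> V" for v using rng[OF that] by (simp add: f_def)
  have finj: "inj_on f V" unfolding inj_on_def using f inj by (metis inj_onD diff_add_cancel)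
  have "f ` V = {0..<n}"
  proof
    show "f ` V \<subseteq> {0..<n}" using f rng hi by (force simp: f_def)
    show "{0..<n} \<subseteq> f ` V"
    proof
      fix i assume "i \<in> {0..<n}"
      then have "lo + int i \<in> d ` V" using img hi by auto
      then obtain v where "v \<in> V" "d v = lo + int i" by auto
      then show "i \<in> f ` V" by (auto simp: f_def image_iff intro!: bexI[of _ v])
    qed
  qed
  then have bij: "bij_betw f V (path_V n)" using finj by (simp add: bij_betw_def path_V_def)
  have fwd: "{f a, f b} \<in> path_E n" if ab: "{a, b} \<in> E" for a b
  proof -
    note se = simple_graph_edgeD[OF sg ab]
    have "d a \<noteq> d b" using inj se by (auto dest: inj_onD)
    then have "f a = Suc (f b) \<or> f b = Suc (f a)"
      using lipschitz1D[OF lip ab] f[OF se(1)] f[OF se(2)] by linarith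
    moreover have "f a < n" "f b < n" using bij se by (auto simp: bij_betw_def path_V_def)
    ultimately show ?thesis by (auto simp: path_E_def insert_commute)
  qed
  have step: "{a, b} \<in> E" if ab: "a \<in> V" "b \<in> V" "f b = Suc (f a)" for a b
  proof -
    obtain x y where xy: "x \<in> V" "y \<in> V" "{x, y} \<in> E" "f x \<le> f a" "\<not> f y \<le> f a"
      using connected_crossing[OF sg cg ab(1,2), of "\<lambda>x. f x \<le> f a"] ab(3) by auto
    have "f x = f a" "f y = f b"
      using lipschitz1D[OF lip xy(3)] f[OF xy(1)] f[OF xy(2)] xy(4,5) ab(3) by linarith+
    then have "x = a" "y = b" using finj xy(1,2) ab(1,2) by (auto dest: inj_onD)
    then show ?thesis using xy(3) by simp
  qed
  have bwd: "{a, b} \<in> E" if ab: "a \<in> V" "b \<in> V" "{f a, f b} \<in> path_E n" for a b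
  proof -
    obtain i where "{f a, f b} = {i, Suc i}" using ab(3) by (auto simp: path_E_def)
    then have "f b = Suc (f a) \<or> f a = Suc (f b)" by (auto simp: doubleton_eq_iff)
    then show ?thesis using step[of a b] step[of b a] ab(1,2) by (auto simp: insert_commute)
  qed
  show ?thesis unfolding graph_iso_def using bij fwd bwd by blast
qed

section \<open>The bound is attained on the path\<close>

lemma sum_abs_centred:
  "2 * (\<Sum>i<c + q. \<bar>int i - int c\<bar>) = int c * (int c + 1) + int q * (int q - 1)"
proof (induction q)
  case 0
  have "2 * (\<Sum>i<c. \<bar>int i - int c\<bar>) = int c * (int c + 1)"
  proof (induction c)
    case (Suc c)
    have "(\<Sum>i<Suc c. \<bar>int i - int (Suc c)\<bar>) = int (Suc c) + (\<Sum>i<c. \<bar>int i - int c\<bar>)"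
      unfolding sum.lessThan_Suc_shift by simp
    then show ?case using Suc by (simp add: algebra_simps)
  qed simp
  then show ?case by simp
next
  case (Suc q)
  then show ?case by (simp add: algebra_simps)
qed

lemma sum_sign_ge: "(\<Sum>i<c + q. if c \<le> i then 1 else - 1 :: int) = int q - int c"
proof (induction q)
  case 0
  have "(\<Sum>i<c. if c \<le> i then 1 else - 1 :: int) = (\<Sum>i<c. - 1)" by (rule sum.cong) auto
  then show ?case by simp
qed simp

text \<open>By convexity the sum grows by at least \<open>- k\<close> times its slope. The index
  \<open>c\<close>, where the term has a kink, counts with sign +1 here, so the slope is
  \<open>q - c\<close>.\<close>

lemma sum_abs_shift_left:
  assumes "c \<le> q" "k \<le> 0"
  shows "(\<Sum>i<c + q. \<bar>int i - int c\<bar>) \<le> (\<Sum>i<c + q. \<bar>int i - int c - k\<bar>)"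
proof -
  have "0 \<le> - k * (int q - int c)" using assms by (intro mult_nonneg_nonneg) auto
  also have "\<dots> = (\<Sum>i<c + q. - k * (if c \<le> i then 1 else - 1))"
    unfolding sum_distrib_left[symmetric] sum_sign_ge ..
  finally have "(\<Sum>i<c + q. \<bar>int i - int c\<bar>)
      \<le> (\<Sum>i<c + q. \<bar>int i - int c\<bar>) + (\<Sum>i<c + q. - k * (if c \<le> i then 1 else - 1))" by simp
  also have "\<dots> \<le> (\<Sum>i<c + q. \<bar>int i - int c - k\<bar>)"
    unfolding sum.distrib[symmetric] by (rule sum_mono) (use assms in auto)
  finally show ?thesis .
qed

text \<open>For a shift to the right the index \<open>c\<close> counts with sign -1, which is why
  the signs switch at \<open>Suc c\<close> and the upper part has size
  \<open>r = q - 1\<close>.\<close>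

lemma sum_abs_shift_right:
  assumes "q \<le> c + 1" "k \<ge> 0"
  shows "(\<Sum>i<c + q. \<bar>int i - int c\<bar>) \<le> (\<Sum>i<c + q. \<bar>int i - int c - k\<bar>)"
proof (cases q)
  case 0
  show ?thesis by (rule sum_mono) (use 0 assms in auto)
next
  case (Suc r)
  have e: "c + q = Suc c + r" using Suc by simp
  have "0 \<le> - k * (int r - int (Suc c))" using assms Suc by (intro mult_nonpos_nonpos) auto
  also have "\<dots> = (\<Sum>i<c + q. - k * (if Suc c \<le> i then 1 else - 1))"
    unfolding sum_distrib_left[symmetric] e sum_sign_ge ..
  finally have "(\<Sum>i<c + q. \<bar>int i - int c\<bar>)
      \<le> (\<Sum>i<c + q. \<bar>int i - int c\<bar>) + (\<Sum>i<c + q. - k * (if Suc c \<le> i then 1 else - 1))" by simp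
  also have "\<dots> \<le> (\<Sum>i<c + q. \<bar>int i - int c - k\<bar>)"
    unfolding sum.distrib[symmetric] by (rule sum_mono) (use assms in auto)
  finally show ?thesis .
qed

text \<open>The path is laid along the integers with \<open>L - 1\<close> vertices below 0, so that
  the cost at 0 equals the bound; no other multiple of 3 is a better centre.\<close>

lemma path_iso_offset_cost_ge:
  assumes sg: "simple_graph V E" and iso: "graph_iso V E (path_V n) (path_E n)"
    and n: "int n + 1 = L + U" "L \<ge> 3" "L + 2 \<le> U" "U \<le> L + 3"
  shows "\<exists>d. lipschitz1 E d \<and> (\<forall>k. L * (L - 1) + U * (U - 1) \<le> 2 * offset_cost V d k)"
proof -
  obtain f where f: "bij_betw f V {..<n}"
      "\<And>u v. u \<in> V \<Longrightarrow> v \<in> V \<Longrightarrow> {u, v} \<in> E \<longleftrightarrow> {f u, f v} \<in> path_E n"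
    using iso unfolding graph_iso_def path_V_def by (metis lessThan_atLeast0)
  define c where "c = nat (L - 1)"
  have c: "int c = L - 1" using n by (simp add: c_def)
  define q where "q = n - c"
  have q: "n = c + q" "int q = U" using n c unfolding q_def by linarith+
  define d where "d v = int (f v) - int c" for v
  have "lipschitz1 E d" unfolding lipschitz1_def
  proof (intro allI impI)
    fix u v assume uv: "{u, v} \<in> E"
    then have "{f u, f v} \<in> path_E n" using f(2) simple_graph_edgeD[OF sg uv] by blast
    then show "\<bar>d u - d v\<bar> \<le> 1" by (auto simp: path_E_def d_def doubleton_eq_iff)
  qed
  moreover have "L * (L - 1) + U * (U - 1) \<le> 2 * offset_cost V d k" for k
  proof -
    have cost: "offset_cost V d j = (\<Sum>i<n. \<bar>int i - int c - 3 * j\<bar>)" for j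
      unfolding offset_cost_def d_def by (rule sum.reindex_bij_betw[OF f(1)])
    have "2 * (\<Sum>i<n. \<bar>int i - int c\<bar>) = int c * (int c + 1) + int q * (int q - 1)"
      unfolding q(1) by (rule sum_abs_centred)
    also have "\<dots> = L * (L - 1) + U * (U - 1)"
      unfolding c q(2) by (simp add: algebra_simps)
    finally have at0: "2 * (\<Sum>i<n. \<bar>int i - int c\<bar>) = L * (L - 1) + U * (U - 1)" .
    show ?thesis
    proof (cases "k \<le> 0")
      case True
      have "c \<le> q" using c q n by linarith
      then show ?thesis using sum_abs_shift_left[of c q "3 * k"] True at0 unfolding cost q(1)[symmetric] by simp
    next
      case False
      define r where "r = q - 3"
      have r: "n = (c + 3) + r" "int r = U - 3" using q n unfolding r_def by linarith+
      \<comment> \<open>Compares the centres 0 and 3: the right side minus the left is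
        \<open>6 * (L + 3 - U)\<close>.\<close>
      have "U * (U - 1) + L * (L - 1) \<le> (L + 2) * (L + 3) + (U - 3) * (U - 4)"
        using n by (simp add: algebra_simps)
      also have "\<dots> = int (c + 3) * (int (c + 3) + 1) + int r * (int r - 1)"
        unfolding of_nat_add c r(2) by (simp add: algebra_simps)
      also have "\<dots> = 2 * (\<Sum>i<n. \<bar>int i - int (c + 3)\<bar>)"
        unfolding r(1) by (rule sum_abs_centred[symmetric])
      also have "\<dots> \<le> 2 * (\<Sum>i<n. \<bar>int i - int (c + 3) - 3 * (k - 1)\<bar>)"
        using sum_abs_shift_right[of r "c + 3" "3 * (k - 1)"] False c r n unfolding r(1)[symmetric] by simp
      also have "(\<Sum>i<n. \<bar>int i - int (c + 3) - 3 * (k - 1)\<bar>) = offset_cost V d k"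
        unfolding cost by (rule sum.cong) auto
      finally show ?thesis by simp
    qed
  qed
  ultimately show ?thesis by blast
qed

lemma two_times_choose_two: "2 * int (x choose 2) = int x * (int x - 1)"
proof -
  have "even (x * (x - 1))" by (cases x) auto
  then have "2 * (x choose 2) = x * (x - 1)" by (simp add: choose_two)
  then have "2 * int (x choose 2) = int (x * (x - 1))" by linarith
  then show ?thesis by (cases x) (auto simp: algebra_simps)
qed

text \<open>The difference \<open>U - L\<close> is 3 for even \<open>n\<close> and 2 for odd
  \<open>n\<close>, and \<open>L\<close> first reaches 3 at \<open>n = 7\<close>.\<close>

lemma path_max_parameters:
  assumes "n \<ge> 7"
  defines "L \<equiv> int ((n + 1) div 2 - 1)" and "U \<equiv> int (n div 2 + 2)"
  shows "int n + 1 = L + U" "L \<ge> 3" "L + 2 \<le> U" "U \<le> L + 3"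
  using assms unfolding L_def U_def by linarith+

lemma diam_C3_le_path:
  assumes T: "grown_tree V E" and n: "card V = n" "n \<ge> 7"
  defines "M \<equiv> (((n + 1) div 2 - 1) choose 2) + ((n div 2 + 2) choose 2)"
  shows "diam_C3 V E \<le> M"
    and "diam_C3 V E = M \<longleftrightarrow> graph_iso V E (path_V n) (path_E n)"
proof -
  define L where "L = int ((n + 1) div 2 - 1)"
  define U where "U = int (n div 2 + 2)"
  note par = path_max_parameters[OF n(2), folded L_def U_def]
  have M: "2 * int M = L * (L - 1) + U * (U - 1)"
    unfolding M_def L_def U_def of_nat_add distrib_left two_times_choose_two ..
  note sg = grown_tree_simple[OF T] and cg = grown_tree_connected[OF T]
  obtain d where d: "lipschitz1 E d" "\<And>k. int (diam_C3 V E) \<le> offset_cost V d k"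
    using diam_C3_attained[OF T] by blast
  obtain k where k: "2 * offset_cost V d k \<le> L * (L - 1) + U * (U - 1)"
      "2 * offset_cost V d k = L * (L - 1) + U * (U - 1) \<longrightarrow> inj_on d V"
    using offset_cost_le_path[OF sg cg d(1), of L U] par n(1) by blast
  show le: "diam_C3 V E \<le> M" using d(2)[of k] k(1) M by linarith
  show "diam_C3 V E = M \<longleftrightarrow> graph_iso V E (path_V n) (path_E n)"
  proof
    assume eq: "diam_C3 V E = M"
    then have "inj_on d V" using d(2)[of k] k M by linarith
    then show "graph_iso V E (path_V n) (path_E n)"
      using inj_lipschitz1_path[OF sg cg d(1)] n(1) by blast
  next
    assume "graph_iso V E (path_V n) (path_E n)"
    then obtain e where e: "lipschitz1 E e" "\<And>k. L * (L - 1) + U * (U - 1) \<le> 2 * offset_cost V e k"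
      using path_iso_offset_cost_ge[OF sg _ par] by blast
    have "int M \<le> offset_cost V e k" for k using e(2)[of k] M by linarith
    then have "M \<le> diam_C3 V E" by (rule diam_C3_ge[OF T e(1)])
    then show "diam_C3 V E = M" using le by simp
  qed
qed

lemma grown_tree_path: "grown_tree (path_V (Suc n)) (path_E (Suc n))"
proof (induction n)
  case 0
  have "path_V (Suc 0) = {0}" "path_E (Suc 0) = {}" by (auto simp: path_V_def path_E_def)
  then show ?case by (simp add: grown_tree.singleton)
next
  case (Suc n)
  have "path_V (Suc (Suc n)) = insert (Suc n) (path_V (Suc n))" by (auto simp: path_V_def)
  moreover have "path_E (Suc (Suc n)) = insert {Suc n, n} (path_E (Suc n))"
    by (auto simp: path_E_def less_Suc_eq)
  ultimately show ?case using grown_tree.add_leaf[OF Suc, of n "Suc n"] by (simp add: path_V_def)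
qed

lemma grown_tree_star: "grown_tree {0..<Suc n} (star_E (Suc n))"
proof (induction n)
  case 0
  have "{0..<Suc 0} = {0}" "star_E (Suc 0) = {}" by (auto simp: star_E_def)
  then show ?case by (simp add: grown_tree.singleton)
next
  case (Suc n)
  have "{0..<Suc (Suc n)} = insert (Suc n) {0..<Suc n}" by auto
  moreover have "star_E (Suc (Suc n)) = insert {Suc n, 0} (star_E (Suc n))"
    by (auto simp: star_E_def less_Suc_eq)
  ultimately show ?case using grown_tree.add_leaf[OF Suc, of 0 "Suc n"] by simp
qed

section \<open>Structure of trees\<close>

definition graph_path :: "'a set set \<Rightarrow> 'a list \<Rightarrow> bool" where
  "graph_path E xs \<longleftrightarrow> distinct xs \<and> (\<forall>i. Suc i < length xs \<longrightarrow> {xs ! i, xs ! Suc i} \<in> E)"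

definition leaf_at :: "'a set set \<Rightarrow> 'a \<Rightarrow> 'a \<Rightarrow> bool" where
  "leaf_at E x y \<longleftrightarrow> {x, y} \<in> E \<and> (\<forall>w. {x, w} \<in> E \<longrightarrow> w = y)"

lemma treeD:
  assumes "is_tree V E"
  shows "simple_graph V E" "connected_graph V E" "\<not> is_cycle E xs"
  using assms by (auto simp: is_tree_def)

lemma graph_path_Cons:
  assumes "graph_path E xs" "xs \<noteq> []" "w \<notin> set xs" "{w, xs ! 0} \<in> E"
  shows "graph_path E (w # xs)"
proof -
  have "{(w # xs) ! i, (w # xs) ! Suc i} \<in> E" if "Suc i < length (w # xs)" for i
    using assms that by (cases i) (auto simp: graph_path_def)
  then show ?thesis using assms by (auto simp: graph_path_def)
qed

lemma graph_path_rev: "graph_path E xs \<Longrightarrow> graph_path E (rev xs)"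
proof -
  assume p: "graph_path E xs"
  have "{rev xs ! i, rev xs ! Suc i} \<in> E" if i: "Suc i < length xs" for i
  proof -
    define j where "j = length xs - Suc (Suc i)"
    have "Suc j < length xs" "rev xs ! i = xs ! Suc j" "rev xs ! Suc i = xs ! j"
      using i by (auto simp: rev_nth j_def Suc_diff_Suc)
    then show ?thesis using p by (auto simp: graph_path_def insert_commute)
  qed
  then show ?thesis using p by (simp add: graph_path_def)
qed

text \<open>The chord closes the segment between its ends; \<open>i + 2 \<le> j\<close> gives that
  segment at least three vertices.\<close>

lemma graph_path_chord_cycle:
  assumes "graph_path E xs" "i + 2 \<le> j" "j < length xs" "{xs ! j, xs ! i} \<in> E"
  shows "is_cycle E (take (Suc (j - i)) (drop i xs))"
  using assms by (auto simp: is_cycle_def graph_path_def last_conv_nth hd_conv_nth)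

lemma tree_no_triangle:
  assumes "is_tree V E" "{a, b} \<in> E" "{b, c} \<in> E" "{c, a} \<in> E"
  shows False
proof -
  note sg = simple_graph_edgeD(3)[OF treeD(1)[OF assms(1)]]
  have "is_cycle E [a, b, c]"
    using assms(2-4) sg[OF assms(2)] sg[OF assms(3)] sg[OF assms(4)]
    by (auto simp: is_cycle_def less_Suc_eq)
  then show False using treeD(3)[OF assms(1)] by blast
qed

lemma tree_no_4_cycle:
  assumes "is_tree V E" "{a, b} \<in> E" "{b, c} \<in> E" "{c, d} \<in> E" "{d, a} \<in> E" "a \<noteq> c" "b \<noteq> d"
  shows False
proof -
  note sg = simple_graph_edgeD(3)[OF treeD(1)[OF assms(1)]]
  have "is_cycle E [a, b, c, d]"
    using assms(2-7) sg[OF assms(2)] sg[OF assms(3)] sg[OF assms(4)] sg[OF assms(5)]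
    by (auto simp: is_cycle_def less_Suc_eq)
  then show False using treeD(3)[OF assms(1)] by blast
qed

lemma tree_no_5_cycle:
  assumes "is_tree V E" "{a, b} \<in> E" "{b, c} \<in> E" "{c, d} \<in> E" "{d, e} \<in> E" "{e, a} \<in> E"
    and "distinct [a, b, c, d, e]"
  shows False
proof -
  have "is_cycle E [a, b, c, d, e]"
    using assms(2-7) by (auto simp: is_cycle_def less_Suc_eq)
  then show False using treeD(3)[OF assms(1)] by blast
qed

lemma graph_path_subset:
  assumes "simple_graph V E" "graph_path E xs" "length xs \<ge> 2"
  shows "set xs \<subseteq> V"
proof
  fix x assume "x \<in> set xs"
  then obtain i where i: "i < length xs" "x = xs ! i" by (auto simp: in_set_conv_nth)
  show "x \<in> V"
  proof (cases i)
    case 0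
    then have "{x, xs ! 1} \<in> E" using assms(2,3) i by (auto simp: graph_path_def)
    then show ?thesis using simple_graph_edgeD[OF assms(1)] by blast
  next
    case (Suc j)
    then have "{xs ! j, x} \<in> E" using assms(2) i by (auto simp: graph_path_def)
    then show ?thesis using simple_graph_edgeD[OF assms(1)] by blast
  qed
qed

lemma graph_path_length_le:
  assumes "simple_graph V E" "V \<noteq> {}" "graph_path E xs"
  shows "length xs \<le> card V"
proof (cases "length xs \<ge> 2")
  case True
  have "distinct xs" using assms(3) by (simp add: graph_path_def)
  then have "length xs = card (set xs)" by (simp add: distinct_card)
  also have "\<dots> \<le> card V"
    by (intro card_mono graph_path_subset[OF assms(1,3) True] simple_graph_finite[OF assms(1)])
  finally show ?thesis .
next
  case False
  then show ?thesis using assms(1,2) simple_graph_finite[OF assms(1)]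
    by (metis Suc_1 Suc_leI card_gt_0_iff linorder_not_le not_less_eq_eq le_trans One_nat_def)
qed

lemma longest_path_exists:
  assumes "simple_graph V E" "connected_graph V E" "card V \<ge> 2"
  shows "\<exists>xs. graph_path E xs \<and> length xs \<ge> 2 \<and> (\<forall>ys. graph_path E ys \<longrightarrow> length ys \<le> length xs)"
proof -
  have fin: "finite V" using assms(1) by (rule simple_graph_finite)
  have ne: "V \<noteq> {}" using assms(3) by auto
  then obtain u where u: "u \<in> V" by blast
  have "V \<noteq> {u}" using assms(3) by auto
  then obtain v where v: "v \<in> V" "v \<noteq> u" using u by blast
  obtain b where b: "{u, b} \<in> E"
    using connected_crossing[OF assms(1,2) u v(1), of "\<lambda>x. x = u"] v(2) by auto
  have p2: "graph_path E [u, b]"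
    using b simple_graph_edgeD(3)[OF assms(1) b] by (auto simp: graph_path_def)
  define m where "m = (GREATEST l. \<exists>xs. graph_path E xs \<and> length xs = l)"
  have bd: "l \<le> card V" if "\<exists>xs. graph_path E xs \<and> length xs = l" for l
    using that graph_path_length_le[OF assms(1) ne] by blast
  have "\<exists>xs. graph_path E xs \<and> length xs = m" unfolding m_def
    using GreatestI_nat[of "\<lambda>l. \<exists>xs. graph_path E xs \<and> length xs = l" 2 "card V"] p2 bd
    by (metis length_Cons list.size(3) numeral_2_eq_2)
  moreover have "length ys \<le> m" if "graph_path E ys" for ys unfolding m_def
    using Greatest_le_nat[of "\<lambda>l. \<exists>xs. graph_path E xs \<and> length xs = l" "length ys" "card V"] that bd
    by blast
  ultimately show ?thesis using p2 by (metis length_Cons list.size(3) numeral_2_eq_2)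
qed

text \<open>A further neighbour of the first vertex would either lie off the path and lengthen it,
  or lie on it and be the end of a chord.\<close>

lemma longest_path_hd_leaf:
  assumes T: "is_tree V E" and p: "graph_path E xs" "length xs \<ge> 2"
    and max: "\<And>ys. graph_path E ys \<Longrightarrow> length ys \<le> length xs"
  shows "leaf_at E (xs ! 0) (xs ! 1)"
  unfolding leaf_at_def
proof (intro conjI allI impI)
  show "{xs ! 0, xs ! 1} \<in> E" using p by (auto simp: graph_path_def)
  fix w assume w: "{xs ! 0, w} \<in> E"
  have ne: "xs \<noteq> []" using p(2) by auto
  have wx: "{w, xs ! 0} \<in> E" using w by (simp add: insert_commute)
  have "w \<in> set xs"
  proof (rule ccontr)
    assume "w \<notin> set xs"
    then show False using max[OF graph_path_Cons[OF p(1) ne _ wx]] by simp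
  qed
  then obtain i where i: "i < length xs" "w = xs ! i" by (auto simp: in_set_conv_nth)
  have "i \<noteq> 0" using simple_graph_edgeD(3)[OF treeD(1)[OF T] w] i(2) by (metis)
  moreover have "\<not> i \<ge> 2"
    using graph_path_chord_cycle[OF p(1), of 0 i] i wx treeD(3)[OF T] by auto
  ultimately have "i = 1" by simp
  then show "w = xs ! 1" using i(2) by simp
qed

lemma tree_has_leaf:
  assumes "is_tree V E" "card V \<ge> 2"
  shows "\<exists>x y. leaf_at E x y"
  using longest_path_exists[OF treeD(1,2)[OF assms(1)] assms(2)] longest_path_hd_leaf[OF assms(1)]
  by blast

lemma tree_remove_leaf:
  assumes T: "is_tree V E" and l: "leaf_at E x y"
  shows "is_tree (V - {x}) (E - {{x, y}})"
proof -
  note sg = treeD(1)[OF T] and cg = treeD(2)[OF T]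
  have xy: "{x, y} \<in> E" and only: "\<And>w. {x, w} \<in> E \<Longrightarrow> w = y" using l by (auto simp: leaf_at_def)
  note se = simple_graph_edgeD[OF sg xy]
  have keep: "{a, b} \<in> E - {{x, y}}" if "{a, b} \<in> E" "a \<noteq> x" "b \<noteq> x" for a b
    using that by auto
  have "simple_graph (V - {x}) (E - {{x, y}})"
    unfolding simple_graph_def
  proof (intro conjI ballI)
    show "finite (V - {x})" using simple_graph_finite[OF sg] by simp
    fix e assume e: "e \<in> E - {{x, y}}"
    then obtain u v where uv: "e = {u, v}" "u \<in> V" "v \<in> V" "u \<noteq> v"
      using sg unfolding simple_graph_def by blast
    have "{u, v} \<in> E" "{v, u} \<in> E" "{u, v} \<noteq> {x, y}" using e uv(1) by (auto simp: insert_commute)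
    then have "u \<noteq> x" "v \<noteq> x" using only by (metis insert_commute)+
    then show "\<exists>u v. e = {u, v} \<and> u \<in> V - {x} \<and> v \<in> V - {x} \<and> u \<noteq> v" using uv by blast
  qed
  moreover have "connected_graph (V - {x}) (E - {{x, y}})"
    unfolding connected_graph_def
  proof (intro conjI ballI)
    show "V - {x} \<noteq> {}" using se by auto
    fix u v assume u: "u \<in> V - {x}" and v: "v \<in> V - {x}"
    have "(u, v) \<in> (adj_rel E)\<^sup>*" using cg u v by (auto simp: connected_graph_def)
    \<comment> \<open>The walk is imitated without \<open>x\<close>: whenever the original walk
      visits the leaf, the imitation waits at \<open>y\<close>.\<close>
    then have "(v \<noteq> x \<longrightarrow> (u, v) \<in> (adj_rel (E - {{x, y}}))\<^sup>*) \<and>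
        (v = x \<longrightarrow> (u, y) \<in> (adj_rel (E - {{x, y}}))\<^sup>*)"
    proof (induction rule: rtrancl_induct)
      case base
      then show ?case using u by auto
    next
      case (step b c)
      have bc: "{b, c} \<in> E" using step(2) by (simp add: adj_rel_def)
      show ?case
      proof (cases "b = x \<or> c = x")
        case True
        then show ?thesis using step(3) only[of b] only[of c] bc se by (auto simp: insert_commute)
      next
        case False
        then have "(b, c) \<in> adj_rel (E - {{x, y}})" using keep[OF bc] by (simp add: adj_rel_def)
        then show ?thesis using False step(3) by (auto intro: rtrancl_into_rtrancl)
      qed
    qed
    then show "(u, v) \<in> (adj_rel (E - {{x, y}}))\<^sup>*" using v by blast
  qed
  moreover have "\<not> is_cycle (E - {{x, y}}) xs" for xs
    using treeD(3)[OF T, of xs] by (auto simp: is_cycle_def)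
  ultimately show ?thesis by (simp add: is_tree_def)
qed

lemma tree_grown: "is_tree V E \<Longrightarrow> grown_tree V E"
proof (induction "card V" arbitrary: V E rule: less_induct)
  case less
  note sg = treeD(1)[OF less.prems] and cg = treeD(2)[OF less.prems]
  have fin: "finite V" using sg by (rule simple_graph_finite)
  have ne: "V \<noteq> {}" using cg by (simp add: connected_graph_def)
  show ?case
  proof (cases "card V \<ge> 2")
    case True
    then obtain x y where l: "leaf_at E x y" using tree_has_leaf[OF less.prems] by blast
    then have xy: "{x, y} \<in> E" by (simp add: leaf_at_def)
    note se = simple_graph_edgeD[OF sg xy]
    have "card (V - {x}) < card V" using se(1) fin by (rule card_Diff1_less[rotated])
    then have "grown_tree (V - {x}) (E - {{x, y}})"
      using less.hyps tree_remove_leaf[OF less.prems l] by blast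
    then have "grown_tree (insert x (V - {x})) (insert {x, y} (E - {{x, y}}))"
      by (rule grown_tree.add_leaf) (use se in auto)
    then show ?thesis using se(1) xy by (simp add: insert_absorb)
  next
    case False
    then have "card V = 1" using ne fin by (metis One_nat_def Suc_1 card_0_eq le_SucE less_Suc_eq_le not_less_eq_eq le_zero_eq)
    then obtain r where r: "V = {r}" by (auto simp: card_1_singleton_iff)
    have "E = {}" using sg r by (fastforce simp: simple_graph_def)
    then show ?thesis using r by (simp add: grown_tree.singleton)
  qed
qed

text \<open>On a longest path with at least 5 vertices, the second and the last but one vertex are
  neighbours of leaves, and adjacency would be a chord: this is case \<open>far\<close>. Otherwise
  no path has 5 vertices, which leaves only stars and double stars.\<close>

lemma tree_trichotomy:
  assumes T: "is_tree V E" and n: "card V \<ge> 3"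
  obtains (star) c where "c \<in> V" "E = (\<lambda>v. {c, v}) ` (V - {c})"
  | (dstar) u v A B where "V = insert u (insert v (A \<union> B))" "u \<noteq> v" "u \<notin> A \<union> B" "v \<notin> A \<union> B"
      "A \<inter> B = {}" "A \<noteq> {}" "B \<noteq> {}"
      "E = insert {u, v} ((\<lambda>a. {u, a}) ` A \<union> (\<lambda>b. {v, b}) ` B)"
  | (far) x y x' y' where "leaf_at E x y" "leaf_at E x' y'" "y \<noteq> y'" "{y, y'} \<notin> E"
proof -
  note sg = treeD(1)[OF T] and cg = treeD(2)[OF T]
  obtain xs where xs: "graph_path E xs" "length xs \<ge> 2"
      "\<And>ys. graph_path E ys \<Longrightarrow> length ys \<le> length xs"
    using longest_path_exists[OF sg cg] n by auto
  define x where "x = xs ! 0"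
  define u where "u = xs ! 1"
  have xu: "leaf_at E x u" unfolding x_def u_def by (rule longest_path_hd_leaf[OF T xs])
  show thesis
  proof (cases "length xs \<ge> 5")
    case True
    define j where "j = length xs - 2"
    have rl: "leaf_at E (rev xs ! 0) (rev xs ! 1)"
      by (rule longest_path_hd_leaf[OF T graph_path_rev[OF xs(1)]]) (use xs(2,3) in auto)
    have uj: "rev xs ! 1 = xs ! j" using True by (simp add: rev_nth j_def numeral_2_eq_2)
    have dist: "distinct xs" using xs(1) by (simp add: graph_path_def)
    have "xs ! 1 \<noteq> xs ! j" using nth_eq_iff_index_eq[OF dist, of 1 j] True by (auto simp: j_def)
    moreover have "{xs ! j, xs ! 1} \<notin> E"
    proof -
      have "1 + 2 \<le> j" "j < length xs" using True by (simp_all add: j_def)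
      then show ?thesis using graph_path_chord_cycle[OF xs(1)] treeD(3)[OF T] by blast
    qed
    ultimately show thesis using far[OF xu rl] unfolding uj u_def by (simp add: insert_commute)
  next
    case False
    have no5: False if "{a, b} \<in> E" "{b, c} \<in> E" "{c, d} \<in> E" "{d, e} \<in> E" "distinct [a, b, c, d, e]" for a b c d e
    proof -
      have "graph_path E [a, b, c, d, e]" using that by (auto simp: graph_path_def less_Suc_eq)
      then show False using xs(3) False by fastforce
    qed
    have xuE: "{x, u} \<in> E" "\<And>w. {x, w} \<in> E \<Longrightarrow> w = u" using xu by (auto simp: leaf_at_def)
    have uV: "u \<in> V" "x \<noteq> u" using simple_graph_edgeD[OF sg xuE(1)] by auto
    show thesis
    proof (cases "\<forall>w\<in>V. w = u \<or> {u, w} \<in> E")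
      case True
      have "E = (\<lambda>v. {u, v}) ` (V - {u})"
      proof
        show "(\<lambda>v. {u, v}) ` (V - {u}) \<subseteq> E" using True by auto
        show "E \<subseteq> (\<lambda>v. {u, v}) ` (V - {u})"
        proof
          fix e assume e: "e \<in> E"
          then obtain p q where pq: "e = {p, q}" "p \<in> V" "q \<in> V" "p \<noteq> q"
            using sg unfolding simple_graph_def by blast
          have "p = u \<or> q = u"
            using tree_no_triangle[OF T, of u p q] True pq e by (auto simp: insert_commute)
          then show "e \<in> (\<lambda>v. {u, v}) ` (V - {u})" using pq by (auto simp: insert_commute)
        qed
      qed
      then show thesis using star uV by blast
    next
      case False
      then obtain z where z: "z \<in> V" "\<not> (z = u \<or> {u, z} \<in> E)" by blast
      \<comment> \<open>Leaving the closed neighbourhood of \<open>u\<close> yields the second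
        centre \<open>v\<close> together with a neighbour \<open>b\<close> of it on the far
        side.\<close>
      obtain v b where vb: "v \<in> V" "b \<in> V" "{v, b} \<in> E" "v = u \<or> {u, v} \<in> E" "b \<noteq> u" "{u, b} \<notin> E"
        using connected_crossing[OF sg cg uV(1) z(1), of "\<lambda>w. w = u \<or> {u, w} \<in> E"] z(2) by auto
      have uv: "{u, v} \<in> E" using vb by auto
      have vu: "{v, u} \<in> E" using uv by (simp add: insert_commute)
      have ne: "u \<noteq> v" "v \<noteq> b" using simple_graph_edgeD(3)[OF sg uv] simple_graph_edgeD(3)[OF sg vb(3)] by auto
      have xv: "x \<noteq> v" using xuE(2) vb(3,5) by auto
      define A where "A = {a. {u, a} \<in> E \<and> a \<noteq> v}"
      define B where "B = {a. {v, a} \<in> E \<and> a \<noteq> u}"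
      have inV: "A \<subseteq> V" "B \<subseteq> V" using simple_graph_edgeD[OF sg] by (auto simp: A_def B_def)
      have nA: "u \<notin> A" "v \<notin> A" "u \<notin> B" "v \<notin> B"
        using simple_graph_edgeD(3)[OF sg, of u u] simple_graph_edgeD(3)[OF sg, of v v]
        by (auto simp: A_def B_def)
      have AB: "A \<inter> B = {}"
        using tree_no_triangle[OF T vu] by (auto simp: A_def B_def insert_commute)
      have xA: "x \<in> A" using xuE(1) xv by (simp add: A_def insert_commute)
      have bB: "b \<in> B" using vb by (simp add: B_def)
      define W where "W = insert u (insert v (A \<union> B))"
      \<comment> \<open>A vertex attached to \<open>W\<close> from outside would produce the
        5-vertex path \<open>q, p, u, v, b\<close> or \<open>q, p, v, u, x\<close>.\<close>
      have "q \<in> W" if pq: "{p, q} \<in> E" "p \<in> W" for p q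
      proof (rule ccontr)
        assume qW: "q \<notin> W"
        have "p \<noteq> u" "p \<noteq> v" using qW pq by (auto simp: W_def A_def B_def)
        then consider "p \<in> A" | "p \<in> B" using pq(2) by (auto simp: W_def)
        then show False
        proof cases
          case 1
          have "{q, p} \<in> E" "{p, u} \<in> E" using pq(1) 1 by (auto simp: A_def insert_commute)
          then show False
            using no5[OF _ _ uv vb(3), of q p] 1 qW nA AB bB ne vb(5) by (auto simp: W_def)
        next
          case 2
          have "{q, p} \<in> E" "{p, v} \<in> E" "{u, x} \<in> E" using pq(1) 2 xuE(1) by (auto simp: B_def insert_commute)
          then show False
            using no5[OF _ _ vu, of q p x] 2 qW nA AB xA ne uV xv by (auto simp: W_def)
        qed
      qed
      moreover have "u \<in> W" by (simp add: W_def)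
      ultimately have "V \<subseteq> W"
        using connected_crossing[OF sg cg uV(1), of _ "\<lambda>w. w \<in> W"] by blast
      then have VW: "V = insert u (insert v (A \<union> B))" using inV uV vb by (auto simp: W_def)
      have "E = insert {u, v} ((\<lambda>a. {u, a}) ` A \<union> (\<lambda>b. {v, b}) ` B)"
      proof
        show "insert {u, v} ((\<lambda>a. {u, a}) ` A \<union> (\<lambda>b. {v, b}) ` B) \<subseteq> E"
          using uv by (auto simp: A_def B_def)
        show "E \<subseteq> insert {u, v} ((\<lambda>a. {u, a}) ` A \<union> (\<lambda>b. {v, b}) ` B)"
        proof
          fix e assume e: "e \<in> E"
          then obtain p q where pq: "e = {p, q}" "p \<in> V" "q \<in> V" "p \<noteq> q"
            using sg unfolding simple_graph_def by blast
          have qp: "{q, p} \<in> E" "{p, q} \<in> E" using e pq by (auto simp: insert_commute)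
          \<comment> \<open>An edge between \<open>A\<close> and \<open>B\<close> closes a 4-cycle
            through both centres; an edge inside \<open>A\<close> or inside \<open>B\<close> closes
            a triangle.\<close>
          have notBA: False if "{s, t} \<in> E" "s \<in> A" "t \<in> B" for s t
          proof (rule tree_no_4_cycle[OF T, of u s t v])
            show "{u, s} \<in> E" "{s, t} \<in> E" "{t, v} \<in> E" "{v, u} \<in> E" "u \<noteq> t" "s \<noteq> v"
              using that vu nA by (auto simp: A_def B_def insert_commute)
          qed
          have notAA: False if "{s, t} \<in> E" "s \<in> A" "t \<in> A" for s t
            by (rule tree_no_triangle[OF T, of u s t]) (use that in \<open>auto simp: A_def insert_commute\<close>)
          have notBB: False if "{s, t} \<in> E" "s \<in> B" "t \<in> B" for s t
            by (rule tree_no_triangle[OF T, of v s t]) (use that in \<open>auto simp: B_def insert_commute\<close>)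
          have uvin: "p \<in> {u, v} \<or> q \<in> {u, v}"
            using pq(2,3) VW notBA[of p q] notBA[of q p] notAA[of p q] notBB[of p q] qp by auto
          have un: "t \<in> insert v A" if "{u, t} \<in> E" for t using that by (auto simp: A_def)
          have vn: "t \<in> insert u B" if "{v, t} \<in> E" for t using that by (auto simp: B_def)
          show "e \<in> insert {u, v} ((\<lambda>a. {u, a}) ` A \<union> (\<lambda>b. {v, b}) ` B)"
            using uvin un[of p] un[of q] vn[of p] vn[of q] qp pq(1) by (auto simp: insert_commute)
        qed
      qed
      then show thesis using dstar[OF VW ne(1)] nA AB xA bB by blast
    qed
  qed
qed

section \<open>The minimum\<close>

text \<open>The distance from \<open>y\<close> capped at 3. Spelling it out by cases reduces all
  estimates to adjacency, and the cap leaves 0 and 3 as the only centres that compete.\<close>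

definition near_dist :: "'a set set \<Rightarrow> 'a \<Rightarrow> 'a \<Rightarrow> int" where
  "near_dist E y v = (if v = y then 0 else if {y, v} \<in> E then 1
     else if \<exists>w. {y, w} \<in> E \<and> {w, v} \<in> E then 2 else 3)"

lemma near_dist_lipschitz1: "lipschitz1 E (near_dist E y)"
proof -
  have half: "near_dist E y v \<le> near_dist E y u + 1" if "{u, v} \<in> E" for u v
    using that unfolding near_dist_def by (auto simp: insert_commute)
  show ?thesis unfolding lipschitz1_def
  proof (intro allI impI)
    fix u v assume uv: "{u, v} \<in> E"
    then have "{v, u} \<in> E" by (simp add: insert_commute)
    then show "\<bar>near_dist E y u - near_dist E y v\<bar> \<le> 1" using half[OF uv] half[of v u] by linarith
  qed
qed

lemma near_dist_self: "near_dist E y y = 0"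
  by (simp add: near_dist_def)

lemma near_dist_bounds: "v \<noteq> y \<Longrightarrow> 1 \<le> near_dist E y v" "near_dist E y v \<le> 3"
  by (auto simp: near_dist_def)

lemma near_dist_ge_2: "v \<noteq> y \<Longrightarrow> {y, v} \<notin> E \<Longrightarrow> 2 \<le> near_dist E y v"
  by (auto simp: near_dist_def)

text \<open>Moving the centre further out than 0 or 3 brings it closer to no vertex. The range
  starts at -1 to allow for a leaf placed below a neighbour at 0.\<close>

lemma offset_cost_ge_ends:
  assumes "\<And>v. v \<in> V \<Longrightarrow> - 1 \<le> d v \<and> d v \<le> 3"
  shows "offset_cost V d 0 \<le> offset_cost V d k \<or> offset_cost V d 1 \<le> offset_cost V d k"
proof (cases "k \<le> 0")
  case True
  then have "\<bar>d v - 3 * 0\<bar> \<le> \<bar>d v - 3 * k\<bar>" if "v \<in> V" for v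
    using assms[OF that] by (cases "k = 0") auto
  then have "offset_cost V d 0 \<le> offset_cost V d k" unfolding offset_cost_def by (rule sum_mono)
  then show ?thesis ..
next
  case False
  then have "\<bar>d v - 3 * 1\<bar> \<le> \<bar>d v - 3 * k\<bar>" if "v \<in> V" for v
    using assms[OF that] by auto
  then have "offset_cost V d 1 \<le> offset_cost V d k" unfolding offset_cost_def by (rule sum_mono)
  then show ?thesis ..
qed

text \<open>Lowering \<open>e\<close> by 1 at a vertex of maximal value keeps it 1-Lipschitz, since
  the neighbours there are equal or smaller by 1. Hence the sum descends in unit steps to any target
  that is at least \<open>card V - 1\<close>.\<close>

lemma lower_lipschitz1_sum:
  assumes sg: "simple_graph V E" and y: "y \<in> V"
    and e0: "lipschitz1 E e0" "e0 y = 0" "\<And>v. v \<in> V - {y} \<Longrightarrow> 1 \<le> e0 v"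
    and j: "int j \<le> (\<Sum>v\<in>V. e0 v) - (int (card V) - 1)"
  shows "\<exists>e. lipschitz1 E e \<and> e y = 0 \<and> (\<forall>v\<in>V - {y}. 1 \<le> e v \<and> e v \<le> e0 v) \<and>
    (\<Sum>v\<in>V. e v) = (\<Sum>v\<in>V. e0 v) - int j"
  using j
proof (induction j)
  case 0
  then show ?case using e0 by (intro exI[of _ e0]) auto
next
  case (Suc j)
  have fin: "finite V" using sg by (rule simple_graph_finite)
  obtain e where e: "lipschitz1 E e" "e y = 0" "\<And>v. v \<in> V - {y} \<Longrightarrow> 1 \<le> e v \<and> e v \<le> e0 v"
      "(\<Sum>v\<in>V. e v) = (\<Sum>v\<in>V. e0 v) - int j"
    using Suc by auto
  obtain v where v: "v \<in> V" "\<And>u. u \<in> V \<Longrightarrow> e u \<le> e v"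
    using finite_ex_max[OF fin, of e] y by blast
  \<comment> \<open>If the maximum were at most 1, the sum would already be down to
    \<open>card V - 1\<close>, leaving no room for another step.\<close>
  have "e v \<ge> 2"
  proof (rule ccontr)
    assume "\<not> e v \<ge> 2"
    then have "e u \<le> 1" if "u \<in> V" for u using v(2)[OF that] by linarith
    then have "(\<Sum>u\<in>V - {y}. e u) \<le> (\<Sum>u\<in>V - {y}. 1)" by (intro sum_mono) auto
    also have "\<dots> = int (card V) - 1" using card_Suc_Diff1[OF fin y] by simp
    finally have "(\<Sum>u\<in>V. e u) \<le> int (card V) - 1"
      using sum.remove[OF fin y, of e] e(2) by simp
    then show False using e(4) Suc.prems by linarith
  qed
  then have vy: "v \<noteq> y" using e(2) by auto
  define e' where "e' = e(v := e v - 1)"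
  have "lipschitz1 E e'" unfolding lipschitz1_def
  proof (intro allI impI)
    fix a b assume ab: "{a, b} \<in> E"
    note se = simple_graph_edgeD[OF sg ab]
    show "\<bar>e' a - e' b\<bar> \<le> 1"
      using lipschitz1D[OF e(1) ab] v(2)[OF se(1)] v(2)[OF se(2)] se(3) by (auto simp: e'_def)
  qed
  moreover have "(\<Sum>u\<in>V. e' u) = (\<Sum>u\<in>V. e0 u) - int (Suc j)"
  proof -
    have "(\<Sum>u\<in>V. e' u) = (\<Sum>u\<in>V. e u - (if u = v then 1 else 0))"
      by (rule sum.cong) (auto simp: e'_def)
    also have "\<dots> = (\<Sum>u\<in>V. e u) - 1" using fin v(1) by (simp add: sum_subtractf)
    finally show ?thesis using e(4) by simp
  qed
  ultimately show ?case using e(2,3) vy \<open>e v \<ge> 2\<close> v(1)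
    by (intro exI[of _ e']) (force simp: e'_def)
qed

text \<open>Truncated distances from a neighbour of a leaf, decreased until their sum is \<open>t\<close>, with the
  value at the leaf then turned from 1 into -1: this leaves the cost at 0 unchanged and raises the
  cost at 3 by 2.\<close>

lemma diam_C3_ge_near_dist_sum:
  assumes T: "grown_tree V E" and l: "leaf_at E x y"
    and t: "int t \<le> (\<Sum>v\<in>V. near_dist E y v)" "card V \<le> t + 1" "2 * t \<le> 3 * card V + 2"
  shows "t \<le> diam_C3 V E"
proof -
  note sg = grown_tree_simple[OF T]
  have fin: "finite V" using sg by (rule simple_graph_finite)
  have xy: "{x, y} \<in> E" and only: "\<And>w. {x, w} \<in> E \<Longrightarrow> w = y" using l by (auto simp: leaf_at_def)
  note se = simple_graph_edgeD[OF sg xy]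
  define j where "j = nat ((\<Sum>v\<in>V. near_dist E y v) - int t)"
  have j: "int j = (\<Sum>v\<in>V. near_dist E y v) - int t" using t(1) by (simp add: j_def)
  have "\<exists>e. lipschitz1 E e \<and> e y = 0 \<and> (\<forall>v\<in>V - {y}. 1 \<le> e v \<and> e v \<le> near_dist E y v) \<and>
      (\<Sum>v\<in>V. e v) = (\<Sum>v\<in>V. near_dist E y v) - int j"
    by (rule lower_lipschitz1_sum[OF sg se(2) near_dist_lipschitz1])
       (use j t near_dist_bounds(1) in \<open>auto simp: near_dist_self\<close>)
  then obtain e where e: "lipschitz1 E e" "e y = 0"
      "\<And>v. v \<in> V - {y} \<Longrightarrow> 1 \<le> e v \<and> e v \<le> near_dist E y v" "(\<Sum>v\<in>V. e v) = int t"
    using j by auto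
  have "near_dist E y x = 1" using se xy by (simp add: near_dist_def insert_commute)
  then have ex: "e x = 1" using e(3)[of x] se by auto
  define d where "d = e(x := - 1)"
  have "lipschitz1 E d" unfolding lipschitz1_def
  proof (intro allI impI)
    fix a b assume ab: "{a, b} \<in> E"
    then have ba: "{b, a} \<in> E" by (simp add: insert_commute)
    show "\<bar>d a - d b\<bar> \<le> 1"
      using lipschitz1D[OF e(1) ab] only[of a] only[of b] ab ba e(2) se(3) by (auto simp: d_def)
  qed
  moreover have "int t \<le> offset_cost V d k" for k
  proof -
    have rng: "0 \<le> e v" "e v \<le> 3" if "v \<in> V" for v
      using e(2) e(3)[of v] that near_dist_bounds(2)[of E y v] by (cases "v = y"; force)+
    have c0: "offset_cost V d 0 = int t" unfolding offset_cost_def e(4)[symmetric]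
      by (rule sum.cong) (use rng ex in \<open>auto simp: d_def\<close>)
    have "offset_cost V d 1 = (\<Sum>v\<in>V. 3 - e v + (if v = x then 2 else 0))" unfolding offset_cost_def
      by (rule sum.cong) (use rng ex in \<open>auto simp: d_def\<close>)
    also have "\<dots> = 3 * int (card V) - int t + 2"
      using fin se(1) by (simp add: sum.distrib sum_subtractf e(4))
    \<comment> \<open>The extra 2 from the turned leaf is just enough for
      \<open>t = 3 * card V div 2 + 1\<close>, one more than a map within the band from 0 to 3 can
      reach.\<close>
    finally have c1: "offset_cost V d 1 \<ge> int t" using t(3) by linarith
    have "offset_cost V d 0 \<le> offset_cost V d k \<or> offset_cost V d 1 \<le> offset_cost V d k"
      by (rule offset_cost_ge_ends) (use rng in \<open>fastforce simp: d_def\<close>)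
    then show ?thesis using c0 c1 by linarith
  qed
  ultimately show ?thesis by (rule diam_C3_ge[OF T])
qed

section \<open>The general lower bound, stars and double stars\<close>

lemma diam_C3_ge_three_halves:
  assumes T: "grown_tree V E"
  shows "3 * card V div 2 \<le> diam_C3 V E"
proof -
  have fin: "finite V" using grown_tree_simple[OF T] by (rule simple_graph_finite)
  \<comment> \<open>With \<open>n = card V\<close>, a set of \<open>n div 2\<close> vertices at 1
    gives the cost \<open>n + n div 2 = 3 * n div 2\<close> at 3, and
    \<open>2 * n - n div 2\<close>, which is no smaller, at 0.\<close>
  obtain S where S: "S \<subseteq> V" "card S = card V div 2"
    using obtain_subset_with_card_n[of "card V div 2" V] by auto
  define d :: "'a \<Rightarrow> int" where "d v = 2 - (if v \<in> S then 1 else 0)" for v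
  have "lipschitz1 E d" by (auto simp: lipschitz1_def d_def)
  moreover have "int (3 * card V div 2) \<le> offset_cost V d k" for k
  proof -
    have s: "(\<Sum>v\<in>V. if v \<in> S then 1 else 0 :: int) = int (card V div 2)"
      using S fin by (simp add: sum.If_cases Int_absorb1)
    have "offset_cost V d 0 = (\<Sum>v\<in>V. 2 - (if v \<in> S then 1 else 0))"
      unfolding offset_cost_def by (rule sum.cong) (auto simp: d_def)
    also have "\<dots> = 2 * int (card V) - int (card V div 2)"
      unfolding sum_subtractf s by simp
    finally have c0: "offset_cost V d 0 = \<dots>" .
    have "offset_cost V d 1 = (\<Sum>v\<in>V. 1 + (if v \<in> S then 1 else 0))"
      unfolding offset_cost_def by (rule sum.cong) (auto simp: d_def)
    also have "\<dots> = int (card V) + int (card V div 2)"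
      unfolding sum.distrib s by simp
    finally have c1: "offset_cost V d 1 = \<dots>" .
    have "offset_cost V d 0 \<le> offset_cost V d k \<or> offset_cost V d 1 \<le> offset_cost V d k"
      by (rule offset_cost_ge_ends) (simp add: d_def)
    then show ?thesis using c0 c1 by linarith
  qed
  ultimately show ?thesis by (rule diam_C3_ge[OF T])
qed

text \<open>Each vertex lies between the two centres, so its distances to them add up to 3. Hence
  one of the two costs is at most half of \<open>3 * card V\<close>.\<close>

lemma offset_costs_in_band:
  assumes "\<And>v. v \<in> V \<Longrightarrow> 3 * k \<le> d v \<and> d v \<le> 3 * k + 3"
  shows "offset_cost V d k + offset_cost V d (k + 1) = 3 * int (card V)"
proof -
  have "offset_cost V d k + offset_cost V d (k + 1) = (\<Sum>v\<in>V. 3)"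
    unfolding offset_cost_def sum.distrib[symmetric] by (rule sum.cong) (use assms in fastforce)+
  then show ?thesis by simp
qed

text \<open>If the value at the centre is a multiple of 3, centring there costs at most 1 per
  vertex. Otherwise it lies strictly between two consecutive multiples, and the leaves cannot leave
  that band.\<close>

lemma star_diam_C3:
  assumes T: "grown_tree V E" and c: "c \<in> V" and E: "E = (\<lambda>v. {c, v}) ` (V - {c})"
  shows "diam_C3 V E = 3 * card V div 2"
proof -
  obtain d where d: "lipschitz1 E d" "\<And>k. int (diam_C3 V E) \<le> offset_cost V d k"
    using diam_C3_attained[OF T] by blast
  have near: "\<bar>d c - d v\<bar> \<le> 1" if "v \<in> V" for v
    using that E lipschitz1D[OF d(1), of c v] by (cases "v = c") auto
  have "2 * int (diam_C3 V E) \<le> 3 * int (card V)"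
  proof (cases "d c mod 3 = 0")
    case True
    then obtain k where k: "d c = 3 * k" by (auto simp: mod_eq_0_iff_dvd dvd_def)
    have "offset_cost V d k \<le> (\<Sum>v\<in>V. 1)" unfolding offset_cost_def
      by (rule sum_mono) (use near k in fastforce)
    then show ?thesis using d(2)[of k] by simp
  next
    case False
    define k where "k = d c div 3"
    have "3 * k + 1 \<le> d c" "d c \<le> 3 * k + 2" using False unfolding k_def by presburger+
    then have "offset_cost V d k + offset_cost V d (k + 1) = 3 * int (card V)"
      by (intro offset_costs_in_band) (use near in fastforce)
    then show ?thesis using d(2)[of k] d(2)[of "k + 1"] by linarith
  qed
  then show ?thesis using diam_C3_ge_three_halves[OF T] by linarith
qed

lemma dstar_sum:
  assumes "finite A" "finite B" "V = insert u (insert v (A \<union> B))" "u \<noteq> v" "u \<notin> A \<union> B" "v \<notin> A \<union> B"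
    "A \<inter> B = {}"
  shows "(\<Sum>x\<in>V. h x) = h u + h v + (\<Sum>x\<in>A. h x) + (\<Sum>x\<in>B. h x :: int)"
  using assms by (simp add: sum.union_disjoint)

lemma dstar_cost_at_centre:
  assumes V: "finite A" "finite B" "V = insert u (insert v (A \<union> B))" "u \<noteq> v" "u \<notin> A \<union> B" "v \<notin> A \<union> B"
      "A \<inter> B = {}"
    and d: "\<bar>d u - d v\<bar> \<le> 1" "\<And>a. a \<in> A \<Longrightarrow> \<bar>d u - d a\<bar> \<le> 1" "\<And>b. b \<in> B \<Longrightarrow> \<bar>d v - d b\<bar> \<le> 1"
    and k: "d u = 3 * k"
  shows "offset_cost V d k \<le> 1 + int (card A) + 2 * int (card B)"
proof -
  have "(\<Sum>x\<in>A. \<bar>d x - 3 * k\<bar>) \<le> (\<Sum>x\<in>A. 1)"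
    by (rule sum_mono) (use d(2) k in fastforce)
  moreover have "(\<Sum>x\<in>B. \<bar>d x - 3 * k\<bar>) \<le> (\<Sum>x\<in>B. 2)"
    by (rule sum_mono) (use d(1,3) k in fastforce)
  ultimately show ?thesis using d(1) k unfolding offset_cost_def dstar_sum[OF V] by simp
qed

lemma dstar_diam_C3_le:
  assumes T: "grown_tree V E" and fin: "finite A" "finite B"
    and V: "V = insert u (insert v (A \<union> B))" "u \<noteq> v" "u \<notin> A \<union> B" "v \<notin> A \<union> B" "A \<inter> B = {}"
    and E: "E = insert {u, v} ((\<lambda>a. {u, a}) ` A \<union> (\<lambda>b. {v, b}) ` B)"
    and bal: "card A \<le> card B + 4" "card B \<le> card A + 4"
  shows "diam_C3 V E \<le> 3 * card V div 2"
proof -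
  have cV: "card V = card A + card B + 2" using fin V by (simp add: card_Un_disjoint)
  obtain d where d: "lipschitz1 E d" "\<And>k. int (diam_C3 V E) \<le> offset_cost V d k"
    using diam_C3_attained[OF T] by blast
  have uv: "\<bar>d u - d v\<bar> \<le> 1" and A: "\<And>a. a \<in> A \<Longrightarrow> \<bar>d u - d a\<bar> \<le> 1"
    and B: "\<And>b. b \<in> B \<Longrightarrow> \<bar>d v - d b\<bar> \<le> 1"
    using d(1) unfolding E lipschitz1_def by auto
  have "2 * int (diam_C3 V E) \<le> 3 * int (card V)"
  proof -
    consider "d u mod 3 = 0" | "d v mod 3 = 0" | "d u mod 3 \<noteq> 0" "d v mod 3 \<noteq> 0" by blast
    then show ?thesis
    proof cases
      case 1
      then obtain k where k: "d u = 3 * k" by (auto simp: mod_eq_0_iff_dvd dvd_def)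
      show ?thesis using dstar_cost_at_centre[OF fin V uv A B k] d(2)[of k] bal cV by linarith
    next
      case 2
      then obtain k where k: "d v = 3 * k" by (auto simp: mod_eq_0_iff_dvd dvd_def)
      have "offset_cost V d k \<le> 1 + int (card B) + 2 * int (card A)"
        by (rule dstar_cost_at_centre[of B A V v u d k]) (use fin V uv A B k in auto)
      then show ?thesis using d(2)[of k] bal cV by linarith
    next
      \<comment> \<open>Two adjacent centres, neither at a multiple of 3, lie strictly between the
        same two multiples, so every leaf stays in that band.\<close>
      case 3
      define k where "k = d u div 3"
      have ub: "3 * k + 1 \<le> d u" "d u \<le> 3 * k + 2" using 3 unfolding k_def by presburger+
      have "d v \<noteq> 3 * k" "d v \<noteq> 3 * k + 3" using 3(2) by auto
      then have vb: "3 * k + 1 \<le> d v" "d v \<le> 3 * k + 2" using uv ub by linarith+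
      have "3 * k \<le> d w \<and> d w \<le> 3 * k + 3" if "w \<in> V" for w
        using that ub vb A[of w] B[of w] unfolding V(1) by auto
      then have "offset_cost V d k + offset_cost V d (k + 1) = 3 * int (card V)"
        by (rule offset_costs_in_band)
      then show ?thesis using d(2)[of k] d(2)[of "k + 1"] by linarith
    qed
  qed
  then show ?thesis by linarith
qed

text \<open>Distances are taken from the centre \<open>u\<close> with fewer leaves, so that each
  leaf of the larger set \<open>B\<close> contributes 2.\<close>

lemma dstar_diam_C3_gt:
  assumes T: "grown_tree V E" and fin: "finite A" "finite B"
    and V: "V = insert u (insert v (A \<union> B))" "u \<noteq> v" "u \<notin> A \<union> B" "v \<notin> A \<union> B" "A \<inter> B = {}"
    and E: "E = insert {u, v} ((\<lambda>a. {u, a}) ` A \<union> (\<lambda>b. {v, b}) ` B)"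
    and ne: "A \<noteq> {}" and unbal: "card A + 5 \<le> card B"
  shows "3 * card V div 2 < diam_C3 V E"
proof -
  have cV: "card V = card A + card B + 2" using fin V by (simp add: card_Un_disjoint)
  obtain x where x: "x \<in> A" using ne by blast
  have leaf: "leaf_at E x u" using x V E by (auto simp: leaf_at_def doubleton_eq_iff)
  have "1 \<le> near_dist E u v" using near_dist_bounds(1) V(2) by metis
  moreover have "(\<Sum>a\<in>A. 1) \<le> (\<Sum>a\<in>A. near_dist E u a)"
  proof (rule sum_mono)
    fix a assume "a \<in> A"
    then have "a \<noteq> u" using V(3) by auto
    then show "1 \<le> near_dist E u a" by (rule near_dist_bounds(1))
  qed
  moreover have "(\<Sum>b\<in>B. 2) \<le> (\<Sum>b\<in>B. near_dist E u b)"
  proof (rule sum_mono)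
    fix b assume b: "b \<in> B"
    then show "2 \<le> near_dist E u b"
      using V by (intro near_dist_ge_2) (auto simp: E doubleton_eq_iff)
  qed
  ultimately have s: "1 + int (card A) + 2 * int (card B) \<le> (\<Sum>w\<in>V. near_dist E u w)"
    unfolding dstar_sum[OF fin V] near_dist_self by simp
  have "3 * card V div 2 + 1 \<le> diam_C3 V E"
  proof (rule diam_C3_ge_near_dist_sum[OF T leaf])
    \<comment> \<open>Twice the right side is \<open>3 * card V + (card B - card A - 4)\<close>,
      where the last term is at least 1.\<close>
    have "3 * card V div 2 + 1 \<le> 1 + card A + 2 * card B" using unbal cV by linarith
    then show "int (3 * card V div 2 + 1) \<le> (\<Sum>w\<in>V. near_dist E u w)" using s by linarith
  qed presburger+
  then show ?thesis by simp
qed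

section \<open>Two leaves with distinct non-adjacent neighbours\<close>

lemma near_dist_1_ge_3:
  assumes T: "is_tree V E" and c: "{y, c} \<in> E" "{c, y'} \<in> E" and y: "y \<noteq> y'" "{y, y'} \<notin> E"
    and v: "{y, v} \<in> E" "v \<noteq> c"
  shows "near_dist E y' v = 3"
proof -
  note sg = simple_graph_edgeD(3)[OF treeD(1)[OF T]]
  have vy: "v \<noteq> y'" using v(1) y by auto
  have yc: "{c, y} \<in> E" "{y', c} \<in> E" using c by (auto simp: insert_commute)
  have 1: "{y', v} \<notin> E"
    using tree_no_4_cycle[OF T v(1) _ yc(2,1)] y(1) v(2) by (auto simp: insert_commute)
  \<comment> \<open>A path of length 2 from \<open>y'\<close> to \<open>v\<close> closes the
    triangle \<open>y, v, c\<close> if its middle is \<open>c\<close>, and the 5-cycle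
    \<open>y, v, w, y', c\<close> otherwise.\<close>
  have 2: False if w: "{y', w} \<in> E" "{w, v} \<in> E" for w
  proof (cases "w = c")
    case True
    then show False using tree_no_triangle[OF T v(1) _ yc(1)] w(2) by (simp add: insert_commute)
  next
    case False
    have vw: "{v, w} \<in> E" "{w, y'} \<in> E" using w by (auto simp: insert_commute)
    have "w \<noteq> y" using w(1) y(2) by (auto simp: insert_commute)
    then show False
      using tree_no_5_cycle[OF T v(1) vw yc(2,1)] y(1) v(2) vy False
        sg[OF v(1)] sg[OF vw(1)] sg[OF vw(2)] sg[OF c(1)] sg[OF c(2)] by auto
  qed
  show ?thesis using vy 1 2 unfolding near_dist_def by auto
qed

text \<open>Only one of the two sums has to exceed \<open>3 * card V div 2\<close>, so they are
  added: small distances to one of \<open>y\<close>, \<open>y'\<close> are compensated by large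
  distances to the other.\<close>

lemma far_leaves_near_dist_sum:
  assumes T: "is_tree V E" and n: "card V \<ge> 7"
    and l: "leaf_at E x y" "leaf_at E x' y'" and y: "y \<noteq> y'" "{y, y'} \<notin> E"
  shows "2 * int (3 * card V div 2) + 1 \<le> (\<Sum>v\<in>V. near_dist E y v) + (\<Sum>v\<in>V. near_dist E y' v)"
proof -
  note sg = treeD(1)[OF T]
  have fin: "finite V" using sg by (rule simple_graph_finite)
  have xy: "{x, y} \<in> E" "{x', y'} \<in> E" and only: "\<And>w. {x, w} \<in> E \<Longrightarrow> w = y" "\<And>w. {x', w} \<in> E \<Longrightarrow> w = y'"
    using l by (auto simp: leaf_at_def)
  note se = simple_graph_edgeD[OF sg xy(1)] simple_graph_edgeD[OF sg xy(2)]
  have y': "{y', y} \<notin> E" using y(2) by (simp add: insert_commute)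
  let ?g = "near_dist E y" and ?g' = "near_dist E y'"
  show ?thesis
  proof (cases "\<exists>c. {y, c} \<in> E \<and> {c, y'} \<in> E")
    case True
    then obtain c where c: "{y, c} \<in> E" "{c, y'} \<in> E" by blast
    have c': "{y', c} \<in> E" "{c, y} \<in> E" using c by (auto simp: insert_commute)
    have cd: "c \<in> V" "c \<noteq> y" "c \<noteq> y'"
      using simple_graph_edgeD[OF sg c(1)] simple_graph_edgeD[OF sg c(2)] by auto
    \<comment> \<open>The vertices \<open>y\<close>, \<open>y'\<close> and \<open>c\<close>
      contribute at least 2 each. Any other vertex contributes at least 4: it has distance 1 to one
      source and capped distance 3 to the other, or at least 2 to both.\<close>
    have pt: "4 - ((if v = y then 2 else 0) + (if v = y' then 2 else 0) + (if v = c then 2 else 0)) \<le> ?g v + ?g' v" for v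
    proof -
      consider "v = y" | "v = y'" | "v = c" | "v \<noteq> y" "v \<noteq> y'" "v \<noteq> c" by blast
      then show ?thesis
      proof cases
        case 1
        then show ?thesis using near_dist_ge_2[of y y' E] y y' cd by (simp add: near_dist_self)
      next
        case 2
        then show ?thesis using near_dist_ge_2[of y' y E] y y' cd by (simp add: near_dist_self)
      next
        case 3
        then show ?thesis using near_dist_bounds(1)[of c y E] near_dist_bounds(1)[of c y' E] cd by simp
      next
        case 4
        have "?g v + ?g' v \<ge> 4"
        proof -
          consider "{y, v} \<in> E" | "{y', v} \<in> E" | "{y, v} \<notin> E" "{y', v} \<notin> E" by blast
          then show ?thesis
          proof cases
            case 1
            then show ?thesis
              using near_dist_1_ge_3[OF T c y 1 4(3)] near_dist_bounds(1)[of v y E] 4(1) by simp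
          next
            case 2
            then show ?thesis
              using near_dist_1_ge_3[OF T c' y(1)[symmetric] y' 2 4(3)] near_dist_bounds(1)[of v y' E] 4(2)
              by simp
          next
            case 3
            then show ?thesis using near_dist_ge_2[of v y E] near_dist_ge_2[of v y' E] 4 by simp
          qed
        qed
        then show ?thesis using 4 by simp
      qed
    qed
    have "4 * int (card V) - 6 = (\<Sum>v\<in>V. 4 - ((if v = y then 2 else 0) + (if v = y' then 2 else 0) + (if v = c then 2 else 0)))"
      using fin se cd by (simp add: sum_subtractf sum.distrib)
    also have "\<dots> \<le> (\<Sum>v\<in>V. ?g v + ?g' v)" by (rule sum_mono) (rule pt)
    finally have "4 * int (card V) - 6 \<le> (\<Sum>v\<in>V. ?g v) + (\<Sum>v\<in>V. ?g' v)" by (simp add: sum.distrib)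
    moreover have "2 * int (3 * card V div 2) + 1 \<le> 4 * int (card V) - 6" using n by linarith
    ultimately show ?thesis by linarith
  next
    case False
    have F: "\<not> ({y, c} \<in> E \<and> {y', c} \<in> E)" "\<not> ({y', c} \<in> E \<and> {c, y} \<in> E)" for c
      using False by (auto simp: insert_commute)
    have xx: "x \<noteq> x'" using only(1)[of y'] xy(2) y(1) by metis
    have xny: "x \<noteq> y'" "x' \<noteq> y" using xy y(2) y' by metis+
    have far: "?g y' = 3" "?g' y = 3" using y y' False F(2) unfolding near_dist_def by simp_all
    have yx: "{y, x} \<in> E" "{y', x'} \<in> E" using xy by (simp_all add: insert_commute)
    have "{y', x} \<notin> E" "{y, x'} \<notin> E" using only(1)[of y'] only(2)[of y] y(1) by (metis insert_commute)+
    moreover have "\<not> ({y', w} \<in> E \<and> {w, x} \<in> E)" "\<not> ({y, w} \<in> E \<and> {w, x'} \<in> E)" for w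
      using only(1)[of w] only(2)[of w] y(2) y' by (metis insert_commute)+
    ultimately have xval: "?g x = 1" "?g' x = 3" "?g' x' = 1" "?g x' = 3"
      using yx se(3,6) xny unfolding near_dist_def by simp_all
    \<comment> \<open>Without a common neighbour the sources have distance at least 3, so every
      vertex contributes at least 3. The leaves \<open>x\<close> and \<open>x'\<close> contribute
      \<open>1 + 3\<close>, which supplies the needed surplus.\<close>
    have pt: "3 + ((if v = x then 1 else 0) + (if v = x' then 1 else 0)) \<le> ?g v + ?g' v" for v
    proof -
      consider "v = x" | "v = x'" | "v = y" | "v = y'" | "v \<noteq> y" "v \<noteq> y'" "v \<noteq> x" "v \<noteq> x'" by blast
      then show ?thesis
      proof cases
        case 5
        have "\<not> ({y, v} \<in> E \<and> {y', v} \<in> E)" by (rule F)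
        then have "?g v + ?g' v \<ge> 3"
          using near_dist_ge_2[of v y E] near_dist_ge_2[of v y' E]
            near_dist_bounds(1)[of v y E] near_dist_bounds(1)[of v y' E] 5(1,2) by linarith
        then show ?thesis using 5 by simp
      qed (use xval xx far se xny in \<open>auto simp: near_dist_self\<close>)
    qed
    have "3 * int (card V) + 2 = (\<Sum>v\<in>V. 3 + ((if v = x then 1 else 0) + (if v = x' then 1 else 0)))"
      using fin se by (simp add: sum.distrib)
    also have "\<dots> \<le> (\<Sum>v\<in>V. ?g v + ?g' v)" by (rule sum_mono) (rule pt)
    finally have "3 * int (card V) + 2 \<le> (\<Sum>v\<in>V. ?g v) + (\<Sum>v\<in>V. ?g' v)" by (simp add: sum.distrib)
    then show ?thesis by linarith
  qed
qed

lemma far_leaves_diam_C3_gt: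
  assumes T: "is_tree V E" and n: "card V \<ge> 7"
    and l: "leaf_at E x y" "leaf_at E x' y'" and y: "y \<noteq> y'" "{y, y'} \<notin> E"
  shows "3 * card V div 2 < diam_C3 V E"
proof -
  let ?t = "3 * card V div 2 + 1"
  have "int ?t \<le> (\<Sum>v\<in>V. near_dist E y v) \<or> int ?t \<le> (\<Sum>v\<in>V. near_dist E y' v)"
    using far_leaves_near_dist_sum[OF assms] by linarith
  moreover have "card V \<le> ?t + 1" "2 * ?t \<le> 3 * card V + 2" by presburger+
  ultimately have "?t \<le> diam_C3 V E"
    using diam_C3_ge_near_dist_sum[OF tree_grown[OF T] l(1)] diam_C3_ge_near_dist_sum[OF tree_grown[OF T] l(2)]
    by blast
  then show ?thesis by simp
qed

section \<open>Isomorphism with the concrete stars and double stars\<close>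

lemma graph_iso_image:
  assumes "bij_betw f V V'" "simple_graph V E"
  shows "graph_iso V E V' ((`) f ` E)"
  unfolding graph_iso_def
proof (intro exI conjI ballI iffI)
  show "bij_betw f V V'" by fact
  have inj: "inj_on f V" using assms(1) by (simp add: bij_betw_def)
  fix u v assume uv: "u \<in> V" "v \<in> V"
  show "{f u, f v} \<in> (`) f ` E" if "{u, v} \<in> E"
    using imageI[OF that, of "(`) f"] by simp
  assume "{f u, f v} \<in> (`) f ` E"
  then obtain e where e: "e \<in> E" "f ` e = f ` {u, v}" by auto
  have "e \<subseteq> V" using e(1) assms(2) by (auto simp: simple_graph_def)
  then have "e = {u, v}" using inj_on_image_eq_iff[OF inj, of e "{u, v}"] e(2) uv by blast
  then show "{u, v} \<in> E" using e(1) by simp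
qed

text \<open>This turns the pairwise condition of \<open>graph_iso\<close> into an equation between
  edge sets, along which the shape of a concrete edge set can be carried over to
  \<open>E\<close>.\<close>

lemma graph_iso_inverse_image:
  assumes iso: "graph_iso V E V' E'" and sg: "simple_graph V E" "simple_graph V' E'"
  shows "\<exists>g. bij_betw g V' V \<and> E = (`) g ` E'"
proof -
  obtain f where f: "bij_betw f V V'"
      "\<And>u v. u \<in> V \<Longrightarrow> v \<in> V \<Longrightarrow> {u, v} \<in> E \<longleftrightarrow> {f u, f v} \<in> E'"
    using iso unfolding graph_iso_def by blast
  define g where "g = inv_into V f"
  have g: "bij_betw g V' V" unfolding g_def using f(1) by (rule bij_betw_inv_into)
  have gf: "g (f v) = v" if "v \<in> V" for v
    unfolding g_def using bij_betw_inv_into_left[OF f(1) that] .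
  have fg: "f (g v) = v" "g v \<in> V" if "v \<in> V'" for v
    using bij_betw_inv_into_right[OF f(1) that] bij_betwE[OF g] that by (simp_all add: g_def)
  have "E = (`) g ` E'"
  proof
    show "E \<subseteq> (`) g ` E'"
    proof
      fix e assume e: "e \<in> E"
      then obtain u v where uv: "e = {u, v}" "u \<in> V" "v \<in> V"
        using sg(1) unfolding simple_graph_def by blast
      then have "{f u, f v} \<in> E'" "e = g ` {f u, f v}" using e f(2) gf by auto
      then show "e \<in> (`) g ` E'" by blast
    qed
    show "(`) g ` E' \<subseteq> E"
    proof
      fix e assume "e \<in> (`) g ` E'"
      then obtain e' where e': "e' \<in> E'" "e = g ` e'" by blast
      then obtain u v where uv: "e' = {u, v}" "u \<in> V'" "v \<in> V'"
        using sg(2) unfolding simple_graph_def by blast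
      then show "e \<in> E" using e' f(2)[of "g u" "g v"] fg by simp
    qed
  qed
  then show ?thesis using g by blast
qed

lemma star_E_image: "star_E n = (\<lambda>i. {0, i}) ` {1..<n}"
  by (auto simp: star_E_def)

lemma dstar_E_image:
  "dstar_E a b = insert {0, 1} ((\<lambda>i. {0, i}) ` {2..<a + 2} \<union> (\<lambda>i. {1, i}) ` {a + 2..<a + b + 2})"
  by (auto simp: dstar_E_def)

lemma simple_graph_star: "simple_graph {0..<n} (star_E n)"
  unfolding simple_graph_def star_E_def by (fastforce intro: exI[of _ 0])

lemma simple_graph_dstar: "simple_graph {0..<a + b + 2} (dstar_E a b)"
proof -
  have "\<exists>u v. e = {u, v} \<and> u \<in> {0..<a + b + 2} \<and> v \<in> {0..<a + b + 2} \<and> u \<noteq> v"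
    if e: "e \<in> dstar_E a b" for e
  proof -
    consider "e = {0, 1}" | i where "e = {0, i}" "2 \<le> i" "i < a + 2"
      | i where "e = {1, i}" "a + 2 \<le> i" "i < a + b + 2"
      using e unfolding dstar_E_def by blast
    then show ?thesis
    proof cases
      case 1
      show ?thesis by (rule exI[of _ 0], rule exI[of _ 1]) (use 1 in auto)
    next
      case (2 i)
      show ?thesis by (rule exI[of _ 0], rule exI[of _ i]) (use 2 in auto)
    next
      case (3 i)
      show ?thesis by (rule exI[of _ 1], rule exI[of _ i]) (use 3 in auto)
    qed
  qed
  then show ?thesis by (simp add: simple_graph_def)
qed

lemma star_isoI:
  assumes sg: "simple_graph V E" and c: "c \<in> V" "E = (\<lambda>v. {c, v}) ` (V - {c})"
  shows "graph_iso V E {0..<card V} (star_E (card V))"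
proof -
  have fin: "finite V" using sg by (rule simple_graph_finite)
  obtain h where h: "bij_betw h (V - {c}) {1..<card V}"
    using finite_same_card_bij[of "V - {c}" "{1..<card V}"] fin c(1) by auto
  define f where "f = h(c := 0)"
  have fh: "bij_betw f (V - {c}) {1..<card V}"
    using h by (rule bij_betw_cong[THEN iffD1, rotated]) (simp add: f_def)
  have "bij_betw f ({c} \<union> (V - {c})) ({0} \<union> {1..<card V})"
    by (rule bij_betw_combine[OF _ fh]) (auto simp: f_def bij_betw_def)
  moreover have "{c} \<union> (V - {c}) = V" using c by auto
  moreover have "{0} \<union> {1..<card V} = {0..<card V}" using c(1) fin card_gt_0_iff by fastforce
  ultimately have bij: "bij_betw f V {0..<card V}" by simp
  have "(`) f ` E = (\<lambda>i. {0, i}) ` f ` (V - {c})"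
    unfolding c(2) image_image by (rule image_cong) (auto simp: f_def)
  also have "\<dots> = star_E (card V)" using fh by (simp add: bij_betw_def star_E_image)
  finally show ?thesis using graph_iso_image[OF bij sg] by simp
qed

lemma star_isoD:
  assumes "graph_iso V E {0..<n} (star_E n)" "simple_graph V E" "n \<ge> 1"
  shows "\<exists>c\<in>V. E = (\<lambda>v. {c, v}) ` (V - {c})"
proof -
  obtain g where g: "bij_betw g {0..<n} V" "E = (`) g ` star_E n"
    using graph_iso_inverse_image[OF assms(1,2) simple_graph_star] by blast
  have gV: "V = g ` {0..<n}" and inj: "inj_on g {0..<n}" using g(1) by (auto simp: bij_betw_def)
  have "{0..<n} - {0} = {1..<n}" by auto
  moreover have "g ` ({0..<n} - {0}) = V - {g 0}"
    using inj assms(3) unfolding gV by (subst inj_on_image_set_diff[OF inj]) auto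
  ultimately have "g ` {1..<n} = V - {g 0}" by simp
  moreover have "E = (\<lambda>v. {g 0, v}) ` g ` {1..<n}" unfolding g(2) star_E_image image_image by simp
  moreover have "g 0 \<in> V" using assms(3) gV by auto
  ultimately show ?thesis by metis
qed

lemma dstar_isoI:
  assumes sg: "simple_graph V E" and fin: "finite A" "finite B"
    and V: "V = insert u (insert v (A \<union> B))" "u \<noteq> v" "u \<notin> A \<union> B" "v \<notin> A \<union> B" "A \<inter> B = {}"
    and E: "E = insert {u, v} ((\<lambda>a. {u, a}) ` A \<union> (\<lambda>b. {v, b}) ` B)"
  shows "graph_iso V E {0..<card A + card B + 2} (dstar_E (card A) (card B))"
proof -
  define a where "a = card A"
  define b where "b = card B"
  have "\<exists>h. bij_betw h A {2..<a + 2}"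
    by (rule finite_same_card_bij[OF fin(1)]) (simp_all add: a_def)
  then obtain h where h: "bij_betw h A {2..<a + 2}" by blast
  have "\<exists>k. bij_betw k B {a + 2..<a + b + 2}"
    by (rule finite_same_card_bij[OF fin(2)]) (simp_all add: b_def)
  then obtain k where k: "bij_betw k B {a + 2..<a + b + 2}" by blast
  define f where "f x = (if x = u then 0 else if x = v then 1 else if x \<in> A then h x else k x)" for x
  have fA: "bij_betw f A {2..<a + 2}"
    by (rule bij_betw_cong[THEN iffD1, OF _ h]) (use V in \<open>auto simp: f_def\<close>)
  have fB: "bij_betw f B {a + 2..<a + b + 2}"
    by (rule bij_betw_cong[THEN iffD1, OF _ k]) (use V in \<open>auto simp: f_def\<close>)
  have fuv: "bij_betw f {u, v} {0, 1}" using V(2) by (auto simp: f_def bij_betw_def)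
  have "bij_betw f ({u, v} \<union> (A \<union> B)) ({0, 1} \<union> ({2..<a + 2} \<union> {a + 2..<a + b + 2}))"
    by (intro bij_betw_combine fuv fA fB) auto
  moreover have "{u, v} \<union> (A \<union> B) = V" using V by auto
  moreover have "{0, 1} \<union> ({2..<a + 2} \<union> {a + 2..<a + b + 2}) = {0..<a + b + 2}" by auto
  ultimately have bij: "bij_betw f V {0..<a + b + 2}" by simp
  have "(`) f ` E = insert {f u, f v} ((\<lambda>i. {f u, i}) ` f ` A \<union> (\<lambda>i. {f v, i}) ` f ` B)"
    unfolding E by (simp add: image_Un image_image)
  also have "\<dots> = dstar_E a b"
    using fA fB V(2) by (simp add: bij_betw_def dstar_E_image f_def[of u] f_def[of v])
  finally show ?thesis using graph_iso_image[OF bij sg] by (simp add: a_def b_def)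
qed

lemma dstar_isoD:
  assumes "graph_iso V E {0..<a + b + 2} (dstar_E a b)" "simple_graph V E"
  obtains u v A B where "finite A" "finite B" "card A = a" "card B = b"
    "V = insert u (insert v (A \<union> B))" "u \<noteq> v" "u \<notin> A \<union> B" "v \<notin> A \<union> B" "A \<inter> B = {}"
    "E = insert {u, v} ((\<lambda>a. {u, a}) ` A \<union> (\<lambda>b. {v, b}) ` B)"
proof -
  obtain g where g: "bij_betw g {0..<a + b + 2} V" "E = (`) g ` dstar_E a b"
    using graph_iso_inverse_image[OF assms simple_graph_dstar] by blast
  have gV: "V = g ` {0..<a + b + 2}" and inj: "inj_on g {0..<a + b + 2}"
    using g(1) by (auto simp: bij_betw_def)
  define A where "A = g ` {2..<a + 2}"
  define B where "B = g ` {a + 2..<a + b + 2}"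
  have eq: "g i = g j \<longleftrightarrow> i = j" if "i < a + b + 2" "j < a + b + 2" for i j
    using inj that by (auto simp: inj_on_eq_iff)
  show thesis
  proof (rule that[of A B "g 0" "g 1"])
    show "finite A" "finite B" by (simp_all add: A_def B_def)
    show "card A = a" "card B = b"
      unfolding A_def B_def using inj by (auto simp: card_image inj_on_subset)
    have "{0..<a + b + 2} = insert 0 (insert 1 ({2..<a + 2} \<union> {a + 2..<a + b + 2}))" by auto
    then show "V = insert (g 0) (insert (g 1) (A \<union> B))"
      unfolding gV A_def B_def by (simp only: image_insert image_Un)
    show "g 0 \<noteq> g 1" using eq[of 0 1] by simp
    show "g 0 \<notin> A \<union> B" "g 1 \<notin> A \<union> B" "A \<inter> B = {}" using eq by (auto simp: A_def B_def)
    show "E = insert {g 0, g 1} ((\<lambda>a. {g 0, a}) ` A \<union> (\<lambda>b. {g 1, b}) ` B)"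
      unfolding g(2) dstar_E_image A_def B_def by (simp add: image_Un image_image)
  qed
qed

lemma tree_diam_C3_min_iff:
  assumes T: "is_tree V E" and n: "card V = n" "n \<ge> 7"
  shows "diam_C3 V E = 3 * n div 2 \<longleftrightarrow>
    graph_iso V E {0..<n} (star_E n) \<or>
    (\<exists>a b. a \<ge> 1 \<and> b \<ge> 1 \<and> a + b + 2 = n \<and> (a \<le> b + 4 \<and> b \<le> a + 4) \<and>
      graph_iso V E {0..<n} (dstar_E a b))"
    (is "_ \<longleftrightarrow> ?S \<or> ?D")
proof
  note sg = treeD(1)[OF T] and G = tree_grown[OF T]
  have fin: "finite V" using sg by (rule simple_graph_finite)
  assume eq: "diam_C3 V E = 3 * n div 2"
  have "card V \<ge> 3" using n by simp
  from T this show "?S \<or> ?D"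
  proof (cases rule: tree_trichotomy)
    case (star c)
    then show ?thesis using star_isoI[OF sg star] n by simp
  next
    case (dstar u v A B)
    have fA: "finite A" "finite B" using fin dstar(1) by auto
    have cV: "n = card A + card B + 2" using fA dstar n by (simp add: card_Un_disjoint)
    have "\<not> card A + 5 \<le> card B"
      using dstar_diam_C3_gt[OF G fA dstar(1-5,8,6)] eq n by auto
    moreover have "\<not> card B + 5 \<le> card A"
      using dstar_diam_C3_gt[OF G fA(2,1), of v u] dstar eq n
      by (auto simp: Un_commute Int_commute insert_commute)
    moreover have "card A \<ge> 1" "card B \<ge> 1" using fA dstar(6,7) by (simp_all add: Suc_leI card_gt_0_iff)
    moreover have "graph_iso V E {0..<n} (dstar_E (card A) (card B))"
      unfolding cV by (rule dstar_isoI[OF sg fA dstar(1-5,8)])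
    ultimately have ?D using cV by (intro exI[of _ "card A"] exI[of _ "card B"]) auto
    then show ?thesis ..
  next
    case (far x y x' y')
    then have "3 * card V div 2 < diam_C3 V E" using far_leaves_diam_C3_gt[OF T] n by simp
    then show ?thesis using eq n by simp
  qed
next
  note sg = treeD(1)[OF T] and G = tree_grown[OF T]
  assume "?S \<or> ?D"
  then show "diam_C3 V E = 3 * n div 2"
  proof
    assume ?S
    then obtain c where "c \<in> V" "E = (\<lambda>v. {c, v}) ` (V - {c})" using star_isoD[OF _ sg, of n] n by fastforce
    then show ?thesis using star_diam_C3[OF G] n by simp
  next
    assume ?D
    then obtain a b where ab: "a + b + 2 = n" "a \<le> b + 4" "b \<le> a + 4"
        "graph_iso V E {0..<a + b + 2} (dstar_E a b)" by auto
    from ab(4) sg obtain u v A B where s: "finite A" "finite B" "card A = a" "card B = b"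
        "V = insert u (insert v (A \<union> B))" "u \<noteq> v" "u \<notin> A \<union> B" "v \<notin> A \<union> B" "A \<inter> B = {}"
        "E = insert {u, v} ((\<lambda>a. {u, a}) ` A \<union> (\<lambda>b. {v, b}) ` B)"
      by (rule dstar_isoD)
    have "diam_C3 V E \<le> 3 * card V div 2"
      by (rule dstar_diam_C3_le[OF G s(1,2,5-10)]) (use ab s(3,4) in auto)
    then show ?thesis using diam_C3_ge_three_halves[OF G] n by simp
  qed
qed

theorem mainTheorem1:
  fixes n :: nat
  assumes "n \<ge> 7"
  defines "M \<equiv> (((n + 1) div 2 - 1) choose 2) + ((n div 2 + 2) choose 2)"
  shows
    "diam_C3 (path_V n) (path_E n) = M
     \<and> (\<forall>(V :: 'a set) E. is_tree V E \<and> card V = n \<longrightarrow>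
          diam_C3 V E \<le> M \<and>
          (diam_C3 V E = M \<longleftrightarrow> graph_iso V E (path_V n) (path_E n)))
     \<and> diam_C3 {0..<n} (star_E n) = 3 * n div 2
     \<and> (\<forall>(V :: 'a set) E. is_tree V E \<and> card V = n \<longrightarrow>
          3 * n div 2 \<le> diam_C3 V E \<and>
          (diam_C3 V E = 3 * n div 2 \<longleftrightarrow>
             graph_iso V E {0..<n} (star_E n) \<or>
             (\<exists>a b. a \<ge> 1 \<and> b \<ge> 1 \<and> a + b + 2 = n \<and>
                    (a \<le> b + 4 \<and> b \<le> a + 4) \<and>
                    graph_iso V E {0..<n} (dstar_E a b))))"
proof (intro conjI allI impI)
  obtain m where m: "n = Suc m" using assms(1) by (cases n) auto
  have "graph_iso (path_V n) (path_E n) (path_V n) (path_E n)"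
    unfolding graph_iso_def by (rule exI[of _ id]) simp
  moreover have "card (path_V n) = n" by (simp add: path_V_def)
  ultimately show "diam_C3 (path_V n) (path_E n) = M"
    using diam_C3_le_path(2)[OF grown_tree_path[of m]] assms(1) unfolding M_def m by simp
  have "star_E n = (\<lambda>v. {0, v}) ` ({0..<n} - {0})" unfolding star_E_image by (rule image_cong) auto
  then show "diam_C3 {0..<n} (star_E n) = 3 * n div 2"
    using star_diam_C3[of "{0..<n}" "star_E n" 0] grown_tree_star[of m] m by simp
next
  fix V :: "'a set" and E
  assume "is_tree V E \<and> card V = n"
  then have T: "is_tree V E" and cV: "card V = n" by auto
  show "diam_C3 V E \<le> M" "diam_C3 V E = M \<longleftrightarrow> graph_iso V E (path_V n) (path_E n)"
    unfolding M_def by (rule diam_C3_le_path[OF tree_grown[OF T] cV assms(1)])+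
  show "3 * n div 2 \<le> diam_C3 V E" using diam_C3_ge_three_halves[OF tree_grown[OF T]] cV by simp
  show "diam_C3 V E = 3 * n div 2 \<longleftrightarrow>
      graph_iso V E {0..<n} (star_E n) \<or>
      (\<exists>a b. a \<ge> 1 \<and> b \<ge> 1 \<and> a + b + 2 = n \<and> (a \<le> b + 4 \<and> b \<le> a + 4) \<and>
        graph_iso V E {0..<n} (dstar_E a b))"
    by (rule tree_diam_C3_min_iff[OF T cV assms(1)])
qed

end
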